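(* Let $p$ be a prime and let $f\in\mathcal B$. Then $f$ is measure-preserving if and only if $f$ is bijective modulo $p^2$. Moreover, $f$ is ergodic if and only if $f$ is transitive modulo $p^2$ (when $p\notin\{2,3\}$), respectively transitive modulo $p^3$ (when $p\in\{2,3\}$).
   Context: $\mathbb Z_p$ denotes the $p$-adic integers with norm $\|\cdot\|_p$; $\binom{x}{i}=x(x-1)\cdots(x-i+1)/i!$. $\mathcal B$ is the set of functions $f\colon\mathbb Z_p\to\mathbb Z_p$ of the form $f(x)=\sum_{i\ge0}a_i\binom{x}{i}$ with $a_i/i!\in\mathbb Z_p$ for all $i$ (such series converge uniformly on $\mathbb Z_p$, and such $f$ are compatible, i.e. $\|f(x)-f(y)\|_p\le\|x-y\|_p$). $f$ is bijective (resp. transitive) modulo $p^k$ if $x\mapsto f(x)\bmod p^k$ induces a bijection (resp. a single-cycle permutation) of $\mathbb Z/p^k$. With $\mu$ the normalized Haar measure, $f$ is measure-preserving if $\mu(f^{-1}(U))=\mu(U)$ for all measurable $U$, and ergodic if moreover $f^{-1}(U)=U$ implies $\mu(U)\in\{0,1\}$; for compatible $f$ these are equivalent to $f$ being bijective, resp. transitive, modulo $p^k$ for every $k\ge1$. *)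

theory Defs
  imports
    "HOL-Probability.Probability"
    "HOL-Combinatorics.Orbits"
    "Berlekamp_Zassenhaus.Finite_Field"
begin

section \<open>The ring of p-adic integers\<close>

text \<open>The prime \<open>p\<close> is \<open>CARD('p)\<close> for a type \<open>'p\<close> of class \<open>prime_card\<close>, and the
  p-adic integers are the inverse limit of the rings \<open>\<int>/p\<^sup>k\<close>. The \<open>k\<close>-th component of an element
  (\<open>padic_residue x k\<close>) is its residue modulo \<open>p\<^sup>k\<close>, represented in \<open>{0..<p\<^sup>k}\<close>.\<close>

typedef ('p :: prime_card) padic_int =
  "{x :: nat \<Rightarrow> int. \<forall>k. x k \<in> {0..<int CARD('p) ^ k} \<and> x (Suc k) mod int CARD('p) ^ k = x k}"
  morphisms padic_residue Abs_padic_int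
proof -
  have "int CARD('p) > 0"
    using prime_gt_0_int[OF prime_card_int[where 'a = 'p]] by simp
  then show ?thesis by (intro exI[of _ "\<lambda>_. 0"]) simp
qed

setup_lifting type_definition_padic_int

lemma p_gt_1: "int CARD('p :: prime_card) > 1"
  using prime_gt_1_int[OF prime_card_int[where 'a = 'p]] by simp

lemma p_pow_pos [simp]: "int CARD('p :: prime_card) ^ k > 0"
  using p_gt_1[where 'p = 'p] by simp

lemma padic_residue_bounds:
  fixes x :: "'p :: prime_card padic_int"
  shows "0 \<le> padic_residue x k" "padic_residue x k < int CARD('p) ^ k"
  using padic_residue[of x] by auto

lemma padic_residue_Suc:
  fixes x :: "'p :: prime_card padic_int"
  shows "padic_residue x (Suc k) mod int CARD('p) ^ k = padic_residue x k"
  using padic_residue[of x] by auto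

lemma padic_residue_mod:
  fixes x :: "'p :: prime_card padic_int"
  assumes "j \<le> k"
  shows "padic_residue x k mod int CARD('p) ^ j = padic_residue x j"
  using assms
proof (induction k rule: dec_induct)
  case base
  then show ?case using padic_residue_bounds[of x j] by simp
next
  case (step n)
  have "int CARD('p) ^ j dvd int CARD('p) ^ n" using step by (simp add: le_imp_power_dvd)
  then have "padic_residue x (Suc n) mod int CARD('p) ^ n mod int CARD('p) ^ j
      = padic_residue x (Suc n) mod int CARD('p) ^ j" by (rule mod_mod_cancel)
  then show ?case using padic_residue_Suc[of x n] step by simp
qed

lemma padic_residue_mod_self [simp]:
  fixes x :: "'p :: prime_card padic_int"
  shows "padic_residue x k mod int CARD('p) ^ k = padic_residue x k"
  by (rule padic_residue_mod) simp

lemma padic_eqI: "(\<And>k. padic_residue x k = padic_residue y k) \<Longrightarrow> x = y"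
  by (simp add: padic_residue_inject[symmetric] fun_eq_iff)

lemma mod_Suc_pow_mod: "a mod (m * m ^ k) mod m ^ k = a mod (m ^ k :: int)"
  by (rule mod_mod_cancel) simp

instantiation padic_int :: (prime_card) comm_ring_1
begin

lift_definition zero_padic_int :: "'a padic_int" is "\<lambda>_. 0"
  by simp

lift_definition one_padic_int :: "'a padic_int" is "\<lambda>k. 1 mod int CARD('a) ^ k"
  by (simp add: mod_Suc_pow_mod)

lift_definition plus_padic_int :: "'a padic_int \<Rightarrow> 'a padic_int \<Rightarrow> 'a padic_int"
  is "\<lambda>x y k. (x k + y k) mod int CARD('a) ^ k"
  apply (simp add: mod_Suc_pow_mod)
  apply (metis mod_add_eq)
  done

lift_definition minus_padic_int :: "'a padic_int \<Rightarrow> 'a padic_int \<Rightarrow> 'a padic_int"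
  is "\<lambda>x y k. (x k - y k) mod int CARD('a) ^ k"
  apply (simp add: mod_Suc_pow_mod)
  apply (metis mod_diff_eq)
  done

lift_definition uminus_padic_int :: "'a padic_int \<Rightarrow> 'a padic_int"
  is "\<lambda>x k. (- x k) mod int CARD('a) ^ k"
  apply (simp add: mod_Suc_pow_mod)
  apply (metis mod_minus_eq)
  done

lift_definition times_padic_int :: "'a padic_int \<Rightarrow> 'a padic_int \<Rightarrow> 'a padic_int"
  is "\<lambda>x y k. (x k * y k) mod int CARD('a) ^ k"
  apply (simp add: mod_Suc_pow_mod)
  apply (metis mod_mult_eq)
  done

instance
proof
  fix a b c :: "'a padic_int"
  show "a * b * c = a * (b * c)"
    by transfer (simp add: mod_simps ac_simps)
  show "a * b = b * a"
    by transfer (simp add: ac_simps)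
  show "1 * a = a"
    by transfer (simp add: mod_simps fun_eq_iff)
  show "a + b + c = a + (b + c)"
    by transfer (simp add: mod_simps ac_simps)
  show "a + b = b + a"
    by transfer (simp add: ac_simps)
  show "0 + a = a"
    by transfer (simp add: fun_eq_iff)
  show "- a + a = 0"
    by transfer (simp add: mod_simps fun_eq_iff)
  show "a - b = a + - b"
    by transfer (simp add: mod_simps fun_eq_iff)
  show "(a + b) * c = a * c + b * c"
    by transfer (simp add: mod_simps fun_eq_iff algebra_simps)
  have "padic_residue (0 :: 'a padic_int) 1 \<noteq> padic_residue 1 1"
    using p_gt_1[where 'p = 'a] by transfer simp
  then show "(0 :: 'a padic_int) \<noteq> 1" by auto
qed

end

lemmas padic_residue_simps =
  zero_padic_int.rep_eq one_padic_int.rep_eq plus_padic_int.rep_eq minus_padic_int.rep_eq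
  uminus_padic_int.rep_eq times_padic_int.rep_eq

lemma padic_residue_of_nat:
  "padic_residue (of_nat n :: 'p :: prime_card padic_int) k = int n mod int CARD('p) ^ k"
  by (induction n) (simp_all add: padic_residue_simps mod_simps add.commute)

lemma padic_residue_of_int:
  "padic_residue (of_int n :: 'p :: prime_card padic_int) k = n mod int CARD('p) ^ k"
  by (cases n rule: int_cases2) (simp_all add: padic_residue_simps padic_residue_of_nat mod_simps)

lemma padic_residue_at_0 [simp]: "padic_residue x 0 = 0"
  using padic_residue_bounds[of x 0] by simp

lemma pow_p_gt: "int n < int CARD('p :: prime_card) ^ n"
proof -
  have "n < CARD('p) ^ n"
    using p_gt_1[where 'p = 'p] by (intro power_gt_expt) simp
  then show ?thesis by (metis of_nat_less_iff of_nat_power)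
qed

instance padic_int :: (prime_card) ring_char_0
proof
  show "inj (of_nat :: nat \<Rightarrow> 'a padic_int)"
  proof (rule injI)
    fix m n :: nat
    assume eq: "(of_nat m :: 'a padic_int) = of_nat n"
    define k where "k = max m n"
    have "int m mod int CARD('a) ^ k = int n mod int CARD('a) ^ k"
      using eq by (metis padic_residue_of_nat)
    moreover have "int m < int CARD('a) ^ k" "int n < int CARD('a) ^ k"
      using pow_p_gt[of k, where 'p = 'a] by (simp_all add: k_def)
    ultimately show "m = n" by simp
  qed
qed

text \<open>The p-adic valuation; its value at \<open>0\<close> is irrelevant.\<close>

definition padic_val :: "'p :: prime_card padic_int \<Rightarrow> nat" where
  "padic_val x = (LEAST k. padic_residue x (Suc k) \<noteq> 0)"

lemma padic_val_nz:
  assumes "x \<noteq> 0"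
  shows "padic_residue x (Suc (padic_val x)) \<noteq> 0" "padic_residue x (padic_val x) = 0"
proof -
  obtain k where k: "padic_residue x k \<noteq> 0"
    using assms padic_eqI[of x 0] by (auto simp: padic_residue_simps)
  then obtain k' where "k = Suc k'" by (cases k) auto
  with k show "padic_residue x (Suc (padic_val x)) \<noteq> 0"
    unfolding padic_val_def by (metis (mono_tags, lifting) LeastI)
  show "padic_residue x (padic_val x) = 0"
  proof (cases "padic_val x")
    case (Suc j)
    then have "\<not> padic_residue x (Suc j) \<noteq> 0"
      unfolding padic_val_def using not_less_Least lessI by metis
    then show ?thesis using Suc by simp
  qed simp
qed

lemma padic_residue_eq_0_mono:
  "padic_residue x k = 0 \<Longrightarrow> j \<le> k \<Longrightarrow> padic_residue x j = 0"
  using padic_residue_mod[of j k x] by simp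

lemma padic_residue_eq_0_iff:
  assumes "x \<noteq> 0"
  shows "padic_residue x k = 0 \<longleftrightarrow> k \<le> padic_val x"
  using padic_val_nz[OF assms] padic_residue_eq_0_mono[of x] not_less_eq_eq by blast

lemma padic_no_zero_divisors:
  fixes x y :: "'p :: prime_card padic_int"
  assumes x: "x \<noteq> 0" and y: "y \<noteq> 0"
  shows "x * y \<noteq> 0"
proof
  assume xy: "x * y = 0"
  let ?p = "int CARD('p)"
  define a b n where "a = padic_val x" and "b = padic_val y" and "n = Suc (a + b)"
  define X Y where "X = padic_residue x n" and "Y = padic_residue y n"
  have "X mod ?p ^ a = 0" "X mod ?p ^ Suc a \<noteq> 0" "Y mod ?p ^ b = 0" "Y mod ?p ^ Suc b \<noteq> 0"
    unfolding X_def Y_def n_def a_def b_def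
    using padic_val_nz[OF x] padic_val_nz[OF y]
    by (subst padic_residue_mod; simp)+
  then obtain X' Y' where X': "X = ?p ^ a * X'" and Y': "Y = ?p ^ b * Y'"
    by (meson dvdE mod_0_imp_dvd)
  have nd: "\<not> ?p dvd X'" "\<not> ?p dvd Y'"
    using \<open>X mod ?p ^ Suc a \<noteq> 0\<close> \<open>Y mod ?p ^ Suc b \<noteq> 0\<close> unfolding X' Y'
    by (auto simp: mult.commute)
  have "X * Y mod ?p ^ n = 0"
    using xy unfolding X_def Y_def by (metis times_padic_int.rep_eq zero_padic_int.rep_eq)
  then have "?p ^ (a + b) * ?p dvd ?p ^ (a + b) * (X' * Y')"
    unfolding X' Y' n_def by (auto simp: power_add ac_simps dest!: mod_0_imp_dvd)
  then have "?p dvd X' * Y'" using p_pow_pos[where 'p = 'p, of "a + b"]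
    by (subst (asm) dvd_mult_cancel_left) auto
  then show False using nd prime_card_int[where 'a = 'p] by (simp add: prime_dvd_mult_iff)
qed

instantiation padic_int :: (prime_card) idom_divide
begin

text \<open>Exact division; the value is \<open>0\<close> when there is no quotient.\<close>

definition divide_padic_int :: "'a padic_int \<Rightarrow> 'a padic_int \<Rightarrow> 'a padic_int" where
  "divide_padic_int x y = (if y \<noteq> 0 \<and> y dvd x then THE z. x = z * y else 0)"

instance
proof
  fix a b :: "'a padic_int"
  show nz: "a \<noteq> 0 \<Longrightarrow> b \<noteq> 0 \<Longrightarrow> a * b \<noteq> 0" for a b :: "'a padic_int"
    by (rule padic_no_zero_divisors)
  show "a div 0 = 0" by (simp add: divide_padic_int_def)
  assume b: "b \<noteq> 0"
  have "z = a" if "a * b = z * b" for z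
  proof -
    have "(z - a) * b = 0" using that by (simp add: algebra_simps)
    then show ?thesis using nz[of "z - a" b] b by auto
  qed
  then show "a * b div b = a"
    using b by (auto simp: divide_padic_int_def intro!: the_equality)
qed

end

section \<open>The p-adic metric\<close>

definition padic_norm :: "'p :: prime_card padic_int \<Rightarrow> real" where
  "padic_norm x = (if x = 0 then 0 else 1 / real CARD('p) ^ padic_val x)"

lemma padic_norm_le_iff:
  fixes x :: "'p :: prime_card padic_int"
  shows "padic_norm x \<le> 1 / real CARD('p) ^ k \<longleftrightarrow> padic_residue x k = 0"
proof (cases "x = 0")
  case False
  have p: "real CARD('p) > 1" using p_gt_1[where 'p = 'p] by simp
  have "padic_norm x \<le> 1 / real CARD('p) ^ k \<longleftrightarrow> real CARD('p) ^ k \<le> real CARD('p) ^ padic_val x"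
    using False p by (simp add: padic_norm_def field_simps)
  also have "\<dots> \<longleftrightarrow> k \<le> padic_val x" using p by simp
  finally show ?thesis using padic_residue_eq_0_iff[OF False] by simp
qed (simp add: padic_norm_def padic_residue_simps)

lemma padic_norm_diff_le_iff:
  fixes x y :: "'p :: prime_card padic_int"
  shows "padic_norm (x - y) \<le> 1 / real CARD('p) ^ k \<longleftrightarrow> padic_residue x k = padic_residue y k"
proof -
  have "padic_residue (x - y) k = 0 \<longleftrightarrow> padic_residue x k = padic_residue y k"
    using mod_eq_dvd_iff[of "padic_residue x k" "int CARD('p) ^ k" "padic_residue y k"]
    by (auto simp: padic_residue_simps)
  then show ?thesis by (simp add: padic_norm_le_iff)
qed

lemma padic_norm_cases:
  fixes x :: "'p :: prime_card padic_int"
  obtains "padic_norm x = 0" "x = 0" | k where "padic_norm x = 1 / real CARD('p) ^ k" "x \<noteq> 0"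
  by (cases "x = 0") (auto simp: padic_norm_def)

lemma padic_norm_minus_commute: "padic_norm (x - y) = padic_norm (y - (x :: 'p :: prime_card padic_int))"
proof -
  have "padic_norm (x - y) \<le> padic_norm (y - x)" for x y :: "'p padic_int"
  proof (cases "y - x" rule: padic_norm_cases)
    case 1
    then show ?thesis by (simp add: padic_norm_def)
  next
    case (2 k)
    then show ?thesis using padic_norm_diff_le_iff[of y x k] padic_norm_diff_le_iff[of x y k]
      by simp
  qed
  then show ?thesis by (meson order_antisym)
qed

lemma padic_norm_ultra: "padic_norm (x - y) \<le> max (padic_norm (x - z)) (padic_norm (z - (y :: 'p :: prime_card padic_int)))"
proof (cases "x = z \<or> z = y")
  case True
  then show ?thesis by (auto simp: padic_norm_def)
next
  case False
  then obtain a b where a: "padic_norm (x - z) = 1 / real CARD('p) ^ a" and b: "padic_norm (z - y) = 1 / real CARD('p) ^ b"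
    by (auto simp: padic_norm_def)
  have p: "real CARD('p) > 1" using p_gt_1[where 'p = 'p] by simp
  have le: "1 / real CARD('p) ^ a \<le> 1 / real CARD('p) ^ min a b"
     "1 / real CARD('p) ^ b \<le> 1 / real CARD('p) ^ min a b"
    using p by (simp_all add: field_simps)
  have "padic_residue x (min a b) = padic_residue z (min a b)"
       "padic_residue z (min a b) = padic_residue y (min a b)"
    using le a b by (simp_all add: padic_norm_diff_le_iff[symmetric])
  then have "padic_norm (x - y) \<le> 1 / real CARD('p) ^ min a b" by (simp add: padic_norm_diff_le_iff)
  then show ?thesis using a b by (auto simp: min_def split: if_splits)
qed

instantiation padic_int :: (prime_card) metric_space
begin

definition dist_padic_int :: "'a padic_int \<Rightarrow> 'a padic_int \<Rightarrow> real" where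
  "dist_padic_int x y = padic_norm (x - y)"

definition uniformity_padic_int :: "('a padic_int \<times> 'a padic_int) filter" where
  "uniformity_padic_int = (INF e\<in>{0 <..}. principal {(x, y). dist x y < e})"

definition open_padic_int :: "'a padic_int set \<Rightarrow> bool" where
  "open_padic_int U \<longleftrightarrow> (\<forall>x\<in>U. eventually (\<lambda>(x', y). x' = x \<longrightarrow> y \<in> U) uniformity)"

instance
proof
  fix x y z :: "'a padic_int"
  have nn: "padic_norm u \<ge> 0" for u :: "'a padic_int"
    by (simp add: padic_norm_def)
  show "dist x y = 0 \<longleftrightarrow> x = y"
    by (simp add: dist_padic_int_def padic_norm_def)
  show "dist x y \<le> dist x z + dist y z"
    using padic_norm_ultra[of x y z] nn[of "x - z"] nn[of "y - z"] padic_norm_minus_commute[of y z]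
    by (auto simp: dist_padic_int_def)
qed (simp_all add: uniformity_padic_int_def open_padic_int_def)

end

lemma padic_dist_le_iff:
  fixes x y :: "'p :: prime_card padic_int"
  shows "dist x y \<le> 1 / real CARD('p) ^ k \<longleftrightarrow> padic_residue x k = padic_residue y k"
  by (simp add: dist_padic_int_def padic_norm_diff_le_iff)

section \<open>Normalized Haar measure\<close>

definition normalized_haar :: "'p :: prime_card padic_int measure \<Rightarrow> bool" where
  "normalized_haar M \<longleftrightarrow> sets M = sets borel \<and> emeasure M UNIV = 1 \<and>
     (\<forall>a. \<forall>A\<in>sets M. emeasure M ((\<lambda>x. a + x) ` A) = emeasure M A)"

definition padic_haar :: "'p :: prime_card padic_int measure" where
  "padic_haar = (THE M. normalized_haar M)"

definition padic_cyl :: "nat \<Rightarrow> int \<Rightarrow> 'p :: prime_card padic_int set" where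
  "padic_cyl k r = {x. padic_residue x k = r}"

lemma padic_open_iff:
  fixes U :: "'p :: prime_card padic_int set"
  shows "open U \<longleftrightarrow> (\<forall>x\<in>U. \<exists>k. padic_cyl k (padic_residue x k) \<subseteq> U)"
proof -
  have p: "real CARD('p) > 1" using p_gt_1[where 'p = 'p] by simp
  have "(\<exists>e>0. \<forall>y. dist y x < e \<longrightarrow> y \<in> U) \<longleftrightarrow> (\<exists>k. padic_cyl k (padic_residue x k) \<subseteq> U)" for x
  proof
    assume "\<exists>e>0. \<forall>y. dist y x < e \<longrightarrow> y \<in> U"
    then obtain e where e: "e > 0" "\<And>y. dist y x < e \<Longrightarrow> y \<in> U" by blast
    obtain k where "(1 / real CARD('p)) ^ k < e"
      using real_arch_pow_inv[of e "1 / real CARD('p)"] e p by auto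
    then have "1 / real CARD('p) ^ k < e" by (simp add: power_divide)
    then have "padic_cyl k (padic_residue x k) \<subseteq> U"
      using e(2) by (auto simp: padic_cyl_def padic_dist_le_iff[symmetric])
    then show "\<exists>k. padic_cyl k (padic_residue x k) \<subseteq> U" by blast
  next
    assume "\<exists>k. padic_cyl k (padic_residue x k) \<subseteq> U"
    then obtain k where "padic_cyl k (padic_residue x k) \<subseteq> U" by blast
    then have "y \<in> U" if "dist y x < 1 / real CARD('p) ^ k" for y
      using that padic_dist_le_iff[of y x k] by (auto simp: padic_cyl_def)
    moreover have "1 / real CARD('p) ^ k > 0" using p by simp
    ultimately show "\<exists>e>0. \<forall>y. dist y x < e \<longrightarrow> y \<in> U" by blast
  qed
  then show ?thesis by (simp add: open_dist)
qed

lemma padic_cyl_Int: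
  assumes "j \<le> k"
  shows "padic_cyl j r \<inter> padic_cyl k s
    = (if s mod int CARD('p) ^ j = r then padic_cyl k s else ({} :: 'p :: prime_card padic_int set))"
  using padic_residue_mod[OF assms, where 'p = 'p] by (auto simp: padic_cyl_def)

lemma padic_cyl_empty: "padic_cyl k (- 1) = ({} :: 'p :: prime_card padic_int set)"
proof -
  have "padic_residue x k \<noteq> - 1" for x :: "'p padic_int" using padic_residue_bounds(1)[of x k] by simp
  then show ?thesis by (simp add: padic_cyl_def)
qed

lemma padic_cyl_0: "padic_cyl 0 0 = UNIV"
  by (auto simp: padic_cyl_def)

abbreviation padic_cyls :: "'p :: prime_card padic_int set set" where
  "padic_cyls \<equiv> range (\<lambda>(k, r). padic_cyl k r)"

lemma Int_stable_padic_cyls: "Int_stable (padic_cyls :: 'p :: prime_card padic_int set set)"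
proof (rule Int_stableI)
  fix A B :: "'p padic_int set"
  assume "A \<in> padic_cyls" "B \<in> padic_cyls"
  then obtain j r k s where AB: "A = padic_cyl j r" "B = padic_cyl k s" by auto
  have e: "{} \<in> (padic_cyls :: 'p padic_int set set)" "padic_cyl i t \<in> (padic_cyls :: 'p padic_int set set)" for i t
    using padic_cyl_empty[symmetric] by (force, force)
  show "A \<inter> B \<in> padic_cyls"
  proof (cases "j \<le> k")
    case True
    then show ?thesis unfolding AB padic_cyl_Int[OF True] using e by auto
  next
    case False
    then have "k \<le> j" by simp
    then show ?thesis unfolding AB Int_commute[of "padic_cyl j r"] padic_cyl_Int[OF \<open>k \<le> j\<close>] using e by auto
  qed
qed

lemma sets_borel_padic:
  "sets (borel :: 'p :: prime_card padic_int measure) = sigma_sets UNIV padic_cyls"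
proof -
  have "sigma_sets UNIV {S :: 'p padic_int set. open S} = sigma_sets UNIV padic_cyls"
  proof (rule sigma_sets_eqI)
    fix U :: "'p padic_int set"
    assume "U \<in> {S. open S}"
    then have U: "open U" by simp
    define I where "I = {kr. case_prod padic_cyl kr \<subseteq> U}"
    have "U = (\<Union>kr\<in>I. case_prod padic_cyl kr)"
    proof
      show "U \<subseteq> (\<Union>kr\<in>I. case_prod padic_cyl kr)"
      proof
        fix x assume "x \<in> U"
        then obtain k where "padic_cyl k (padic_residue x k) \<subseteq> U" using U padic_open_iff by blast
        then have "(k, padic_residue x k) \<in> I" by (simp add: I_def)
        then show "x \<in> (\<Union>kr\<in>I. case_prod padic_cyl kr)" by (force simp: padic_cyl_def)
      qed
    qed (auto simp: I_def)
    moreover have "(\<Union>kr\<in>I. case_prod padic_cyl kr) \<in> sigma_sets UNIV padic_cyls"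
      by (rule sigma_sets_UNION) (auto intro: sigma_sets.Basic)
    ultimately show "U \<in> sigma_sets UNIV padic_cyls" by simp
  next
    fix A :: "'p padic_int set"
    assume "A \<in> padic_cyls"
    then have "open A" by (auto simp: padic_open_iff padic_cyl_def)
    then show "A \<in> sigma_sets UNIV {S. open S}" by (simp add: sigma_sets.Basic)
  qed
  then show ?thesis by (simp add: borel_def)
qed

lemma padic_cyl_borel [measurable, simp]: "padic_cyl k r \<in> sets borel"
  unfolding sets_borel_padic by (rule sigma_sets.Basic) auto

lemma padic_cyl_out:
  assumes "r \<notin> {0..<int CARD('p) ^ k}"
  shows "padic_cyl k r = ({} :: 'p :: prime_card padic_int set)"
  using assms padic_residue_bounds[where 'p = 'p] by (auto simp: padic_cyl_def)

lemma padic_measure_eqI: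
  fixes M N :: "'p :: prime_card padic_int measure"
  assumes "sets M = sets borel" "sets N = sets borel" "emeasure M UNIV \<noteq> \<infinity>"
    and eq: "\<And>k r. r \<in> {0..<int CARD('p) ^ k} \<Longrightarrow> emeasure M (padic_cyl k r) = emeasure N (padic_cyl k r)"
  shows "M = N"
proof (rule measure_eqI_generator_eq[where E = padic_cyls and \<Omega> = UNIV and A = "\<lambda>_. UNIV"])
  fix X :: "'p padic_int set"
  assume "X \<in> padic_cyls"
  then obtain k r where X: "X = padic_cyl k r" by auto
  show "emeasure M X = emeasure N X"
    using eq[of r k] padic_cyl_out[of r k, where 'p = 'p] X
    by (cases "r \<in> {0..<int CARD('p) ^ k}") auto
next
  show "range (\<lambda>_ :: nat. UNIV :: 'p padic_int set) \<subseteq> padic_cyls"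
    using padic_cyl_0[symmetric] by force
qed (use assms in \<open>simp_all add: sets_borel_padic Int_stable_padic_cyls\<close>)

lemma padic_cyl_translate:
  fixes a :: "'p :: prime_card padic_int"
  assumes "r \<in> {0..<int CARD('p) ^ k}"
  shows "(\<lambda>x. x - a) -` padic_cyl k r = padic_cyl k ((r + padic_residue a k) mod int CARD('p) ^ k)"
proof -
  let ?q = "int CARD('p) ^ k"
  have "padic_residue (x - a) k = r \<longleftrightarrow> padic_residue x k = (r + padic_residue a k) mod ?q" for x
  proof
    assume *: "padic_residue (x - a) k = r"
    have "padic_residue x k = padic_residue ((x - a) + a) k" by simp
    also have "\<dots> = (r + padic_residue a k) mod ?q"
      unfolding plus_padic_int.rep_eq * ..
    finally show "padic_residue x k = (r + padic_residue a k) mod ?q" .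
  next
    assume *: "padic_residue x k = (r + padic_residue a k) mod ?q"
    have "padic_residue (x - a) k = r mod ?q"
      unfolding minus_padic_int.rep_eq * by (simp add: mod_simps)
    then show "padic_residue (x - a) k = r" using assms by simp
  qed
  then show ?thesis by (auto simp: padic_cyl_def)
qed

lemma padic_translate_image:
  fixes a :: "'p :: prime_card padic_int"
  shows "(\<lambda>x. a + x) ` A = (\<lambda>x. x - a) -` A"
  by (auto simp: image_iff) (metis add.commute diff_add_cancel)

lemma padic_measurable_translate [measurable]:
  "(\<lambda>x :: 'p :: prime_card padic_int. x - a) \<in> borel_measurable borel"
proof (rule measurable_sigma_sets[where \<Omega> = UNIV and A = padic_cyls])
  fix y :: "'p padic_int set"
  assume "y \<in> padic_cyls"
  then obtain k r where y: "y = padic_cyl k r" by auto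
  show "(\<lambda>x. x - a) -` y \<inter> space borel \<in> sets borel"
    using padic_cyl_translate[of r k a] padic_cyl_out[of r k, where 'p = 'p] y
    by (cases "r \<in> {0..<int CARD('p) ^ k}") auto
qed (simp_all add: sets_borel_padic)

lemma haar_cyl:
  fixes M :: "'p :: prime_card padic_int measure"
  assumes M: "normalized_haar M" and r: "r \<in> {0..<int CARD('p) ^ k}"
  shows "emeasure M (padic_cyl k r) = 1 / of_nat (CARD('p) ^ k)"
proof -
  let ?q = "int CARD('p) ^ k"
  have sets: "sets M = sets borel" and one: "emeasure M UNIV = 1"
    and inv: "\<And>a A. A \<in> sets M \<Longrightarrow> emeasure M ((\<lambda>x. a + x) ` A) = emeasure M A"
    using M by (auto simp: normalized_haar_def)
  have eq: "emeasure M (padic_cyl k s) = emeasure M (padic_cyl k 0)" if s: "s \<in> {0..<?q}" for s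
  proof -
    have "(\<lambda>x. of_int s + x) ` padic_cyl k 0 = (padic_cyl k s :: 'p padic_int set)"
      unfolding padic_translate_image using s
      by (subst padic_cyl_translate) (simp_all add: padic_residue_of_int)
    then show ?thesis using inv[of "padic_cyl k 0" "of_int s"] sets by simp
  qed
  have "(\<Union>s\<in>{0..<?q}. padic_cyl k s) = (UNIV :: 'p padic_int set)"
    using padic_residue_bounds[where 'p = 'p] by (auto simp: padic_cyl_def)
  then have "1 = emeasure M (\<Union>s\<in>{0..<?q}. padic_cyl k s)" using one by simp
  also have "\<dots> = (\<Sum>s\<in>{0..<?q}. emeasure M (padic_cyl k s))"
  proof (rule sum_emeasure[symmetric])
    show "disjoint_family_on (padic_cyl k :: int \<Rightarrow> 'p padic_int set) {0..<?q}"
      by (auto simp: disjoint_family_on_def padic_cyl_def)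
  qed (auto simp: sets)
  also have "\<dots> = (\<Sum>s\<in>{0..<?q}. emeasure M (padic_cyl k r))"
    by (rule sum.cong[OF refl]) (rule trans[OF eq eq[OF r, symmetric]])
  also have "\<dots> = of_nat (CARD('p) ^ k) * emeasure M (padic_cyl k r)"
    by (simp add: nat_power_eq)
  finally have *: "of_nat (CARD('p) ^ k) * emeasure M (padic_cyl k r) = 1" by simp
  have nz: "(of_nat (CARD('p) ^ k) :: ennreal) \<noteq> 0" using p_gt_1[where 'p = 'p] by simp
  have nt: "(of_nat (CARD('p) ^ k) :: ennreal) \<noteq> top_class.top" using ennreal_of_nat_neq_top by blast
  have "emeasure M (padic_cyl k r) = of_nat (CARD('p) ^ k) * emeasure M (padic_cyl k r) / of_nat (CARD('p) ^ k)"
    using ennreal_mult_divide_eq[OF nz nt] by (metis mult.commute)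
  then show ?thesis using * by simp
qed

text \<open>Existence, through the law of a sequence of independent uniform digits.\<close>

lemma digit_sum_bounds:
  fixes p :: int assumes "p > 0"
  shows "(\<Sum>i<k. (d i mod p) * p ^ i) \<in> {0..<p ^ k}"
proof (induction k)
  case (Suc k)
  have "(d k mod p) * p ^ k \<le> (p - 1) * p ^ k" using assms by (intro mult_right_mono) auto
  moreover have "(d k mod p) * p ^ k \<ge> 0" using assms by simp
  ultimately show ?case using Suc by (auto simp: algebra_simps)
qed simp

lemma digit_sum_eq_iff:
  fixes p :: int assumes p: "p > 0" and "r \<in> {0..<p ^ k}"
  shows "(\<Sum>i<k. (d i mod p) * p ^ i) = r \<longleftrightarrow> (\<forall>i<k. d i mod p = r div p ^ i mod p)"
  using assms(2)
proof (induction k arbitrary: r)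
  case (Suc k)
  let ?S = "\<Sum>i<k. (d i mod p) * p ^ i"
  have S: "?S \<in> {0..<p ^ k}" by (rule digit_sum_bounds[OF p])
  have rk: "r div p ^ k mod p = r div p ^ k"
  proof -
    have "r div p ^ k * p ^ k = r - r mod p ^ k" by (rule minus_mod_eq_div_mult[symmetric])
    also have "\<dots> \<le> r" using p by simp
    also have "\<dots> < p * p ^ k" using Suc.prems by simp
    finally have "r div p ^ k < p" using p by simp
    moreover have "0 \<le> r div p ^ k" using Suc.prems p by (simp add: pos_imp_zdiv_nonneg_iff)
    ultimately show ?thesis by simp
  qed
  have "?S + (d k mod p) * p ^ k = r \<longleftrightarrow> ?S = r mod p ^ k \<and> d k mod p = r div p ^ k"
  proof
    assume *: "?S + (d k mod p) * p ^ k = r"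
    have "r mod p ^ k = ?S" "r div p ^ k = d k mod p"
      unfolding *[symmetric] using S p by simp_all
    then show "?S = r mod p ^ k \<and> d k mod p = r div p ^ k" by simp
  next
    assume "?S = r mod p ^ k \<and> d k mod p = r div p ^ k"
    then show "?S + (d k mod p) * p ^ k = r" by (simp only: mod_div_mult_eq)
  qed
  also have "?S = r mod p ^ k \<longleftrightarrow> (\<forall>i<k. d i mod p = (r mod p ^ k) div p ^ i mod p)"
    using p by (intro Suc.IH) simp
  also have "\<dots> \<longleftrightarrow> (\<forall>i<k. d i mod p = r div p ^ i mod p)"
  proof (intro all_cong1 imp_cong refl)
    fix i assume i: "i < k"
    have "p ^ k = p ^ i * p ^ (k - i)" using i by (simp flip: power_add)
    then have "r mod p ^ k = p ^ i * (r div p ^ i mod p ^ (k - i)) + r mod p ^ i"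
      using p by (metis zmod_zmult2_eq zero_le_power less_imp_le)
    then have "(r mod p ^ k) div p ^ i = r div p ^ i mod p ^ (k - i)"
      using p by simp
    moreover have "p dvd p ^ (k - i)" using i by simp
    ultimately have "(r mod p ^ k) div p ^ i mod p = r div p ^ i mod p"
      by (simp add: mod_mod_cancel)
    then show "(d i mod p = (r mod p ^ k) div p ^ i mod p) = (d i mod p = r div p ^ i mod p)" by simp
  qed
  finally show ?case using rk by (auto simp: less_Suc_eq)
qed simp

lift_definition padic_of_digits :: "(nat \<Rightarrow> int) \<Rightarrow> 'p :: prime_card padic_int" is
  "\<lambda>d k. \<Sum>i<k. (d i mod int CARD('p)) * int CARD('p) ^ i"
  subgoal for d
    using digit_sum_bounds[of "int CARD('p)" d] p_gt_1[where 'p = 'p] by auto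
  done

lemma ex_haar: "\<exists>M :: 'p :: prime_card padic_int measure. normalized_haar M"
proof -
  let ?p = "int CARD('p)"
  let ?U = "uniform_count_measure {0..<?p}"
  let ?P = "PiM (UNIV :: nat set) (\<lambda>_. ?U)"
  have p: "?p > 0" using p_gt_1[where 'p = 'p] by simp
  interpret U: prob_space ?U using p by (intro prob_space_uniform_count_measure) auto
  interpret P: product_prob_space "\<lambda>_ :: nat. ?U" UNIV ..
  define T :: "(nat \<Rightarrow> int) \<Rightarrow> 'p padic_int" where "T = padic_of_digits"
  have pre: "T -` padic_cyl k r \<inter> space ?P
      = prod_emb UNIV (\<lambda>_. ?U) {..<k} (Pi\<^sub>E {..<k} (\<lambda>i. {r div ?p ^ i mod ?p}))"
    if r: "r \<in> {0..<?p ^ k}" for k r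
  proof -
    have "d \<in> T -` padic_cyl k r \<longleftrightarrow> (\<forall>i<k. d i = r div ?p ^ i mod ?p)"
      if d: "\<And>i. d i \<in> {0..<?p}" for d
    proof -
      have "d i mod ?p = d i" for i using d[of i] by simp
      then show ?thesis using digit_sum_eq_iff[OF p r, of d]
        by (simp add: T_def padic_cyl_def padic_of_digits.rep_eq)
    qed
    then show ?thesis
      by (auto simp: prod_emb_def space_PiM space_uniform_count_measure PiE_iff restrict_def
          extensional_def)
  qed
  have in_sets: "{r div ?p ^ i mod ?p} \<in> sets ?U" for r i
    using p by (simp add: sets_uniform_count_measure)
  have T: "T \<in> measurable ?P borel"
  proof (rule measurable_sigma_sets[where \<Omega> = UNIV and A = padic_cyls])
    fix y :: "'p padic_int set"
    assume "y \<in> padic_cyls"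
    then obtain k r where y: "y = padic_cyl k r" by auto
    show "T -` y \<inter> space ?P \<in> sets ?P"
    proof (cases "r \<in> {0..<?p ^ k}")
      case True
      show ?thesis unfolding y pre[OF True] using in_sets
        by (intro sets_PiM_I) auto
    next
      case False
      then show ?thesis using padic_cyl_out[OF False] y by simp
    qed
  qed (simp_all add: sets_borel_padic)
  define M where "M = distr ?P borel T"
  have sM: "sets M = sets borel" by (simp add: M_def)
  have cyl: "emeasure M (padic_cyl k r) = (ennreal (1 / real CARD('p))) ^ k"
    if r: "r \<in> {0..<?p ^ k}" for k r
  proof -
    have "emeasure M (padic_cyl k r)
        = emeasure ?P (prod_emb UNIV (\<lambda>_. ?U) {..<k} (Pi\<^sub>E {..<k} (\<lambda>i. {r div ?p ^ i mod ?p})))"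
      unfolding M_def by (subst emeasure_distr[OF T]) (simp_all only: pre[OF r] padic_cyl_borel)
    also have "\<dots> = (\<Prod>i\<in>{..<k}. emeasure ?U {r div ?p ^ i mod ?p})"
      using in_sets by (intro P.emeasure_PiM_emb) auto
    also have "\<dots> = (\<Prod>i\<in>{..<k}. ennreal (1 / real CARD('p)))"
      using p by (intro prod.cong refl) (subst emeasure_uniform_count_measure, auto)
    finally show ?thesis by simp
  qed
  have one: "emeasure M UNIV = 1"
    using cyl[of 0 0] by (simp add: padic_cyl_0)
  have "emeasure M ((\<lambda>x. a + x) ` A) = emeasure M A" if A: "A \<in> sets M" for a A
  proof -
    define N where "N = distr M borel (\<lambda>x. x - a)"
    have ta: "(\<lambda>x. x - a) \<in> measurable M borel"
      using padic_measurable_translate[of a] measurable_cong_sets[OF sM refl] by blast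
    have sp: "space M = UNIV" using sets_eq_imp_space_eq[OF sM] by simp
    have N: "emeasure N B = emeasure M ((\<lambda>x. x - a) -` B)" if "B \<in> sets borel" for B
      unfolding N_def using that sp by (subst emeasure_distr[OF ta]) simp_all
    have "M = N"
    proof (rule padic_measure_eqI[OF sM])
      show "sets N = sets borel" by (simp add: N_def)
      show "emeasure M UNIV \<noteq> \<infinity>" using one by simp
      fix k r assume r: "r \<in> {0..<?p ^ k}"
      have "emeasure N (padic_cyl k r) = emeasure M (padic_cyl k ((r + padic_residue a k) mod ?p ^ k))"
        by (simp add: N padic_cyl_translate[OF r])
      also have "\<dots> = ennreal (1 / real CARD('p)) ^ k" by (rule cyl) simp
      finally show "emeasure M (padic_cyl k r) = emeasure N (padic_cyl k r)" using cyl[OF r] by simp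
    qed
    then show ?thesis using N[of A] A sM unfolding padic_translate_image by simp
  qed
  then have "normalized_haar M" using sM one by (simp add: normalized_haar_def)
  then show ?thesis by blast
qed

lemma ex1_haar: "\<exists>!M :: 'p :: prime_card padic_int measure. normalized_haar M"
proof (rule ex_ex1I[OF ex_haar])
  fix M N :: "'p padic_int measure"
  assume "normalized_haar M" "normalized_haar N"
  then show "M = N"
    by (intro padic_measure_eqI) (simp_all add: haar_cyl, simp_all add: normalized_haar_def)
qed

lemma normalized_haar_padic_haar: "normalized_haar padic_haar"
  unfolding padic_haar_def by (rule theI'[OF ex1_haar])

definition measure_preserving :: "('p :: prime_card padic_int \<Rightarrow> 'p padic_int) \<Rightarrow> bool" where
  "measure_preserving f \<longleftrightarrow> f \<in> measurable padic_haar padic_haar \<and>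
     (\<forall>U\<in>sets padic_haar. measure padic_haar (f -` U) = measure padic_haar U)"

definition ergodic :: "('p :: prime_card padic_int \<Rightarrow> 'p padic_int) \<Rightarrow> bool" where
  "ergodic f \<longleftrightarrow> measure_preserving f \<and>
     (\<forall>U\<in>sets padic_haar. f -` U = U \<longrightarrow> measure padic_haar U \<in> {0, 1})"

section \<open>Maps modulo powers of p and the class B\<close>

definition induces_mod ::
  "('p :: prime_card padic_int \<Rightarrow> 'p padic_int) \<Rightarrow> nat \<Rightarrow> (int \<Rightarrow> int) \<Rightarrow> bool" where
  "induces_mod f k g \<longleftrightarrow> (\<forall>x. padic_residue (f x) k = g (padic_residue x k))"

definition bijective_mod :: "('p :: prime_card padic_int \<Rightarrow> 'p padic_int) \<Rightarrow> nat \<Rightarrow> bool" where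
  "bijective_mod f k \<longleftrightarrow>
     (\<exists>g. induces_mod f k g \<and> bij_betw g {0..<int CARD('p) ^ k} {0..<int CARD('p) ^ k})"

definition transitive_mod :: "('p :: prime_card padic_int \<Rightarrow> 'p padic_int) \<Rightarrow> nat \<Rightarrow> bool" where
  "transitive_mod f k \<longleftrightarrow>
     (\<exists>g. induces_mod f k g \<and> bij_betw g {0..<int CARD('p) ^ k} {0..<int CARD('p) ^ k} \<and>
       cyclic_on g {0..<int CARD('p) ^ k})"

text \<open>The division is exact: \<open>i!\<close> divides \<open>x (x - 1) \<dots> (x - i + 1)\<close> in the p-adic integers. The
  formula is that of \<open>gchoose\<close>, which the library restricts to fields.\<close>

definition padic_binom :: "'p :: prime_card padic_int \<Rightarrow> nat \<Rightarrow> 'p padic_int" where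
  "padic_binom x i = (\<Prod>j=0..<i. x - of_nat j) div fact i"

text \<open>\<open>a\<^sub>i / i! \<in> \<int>\<^sub>p\<close> is divisibility of \<open>a\<^sub>i\<close> by \<open>i!\<close> in the p-adic integers.\<close>

definition padic_B :: "('p :: prime_card padic_int \<Rightarrow> 'p padic_int) set" where
  "padic_B = {f. \<exists>a. (\<forall>i. fact i dvd a i) \<and> (\<forall>x. (\<lambda>i. a i * padic_binom x i) sums f x)}"

end

theory Submission
  imports Defs "HOL-Number_Theory.Number_Theory"
begin

text \<open>Since \<open>i!\<close> divides \<open>x (x - 1) \<dots> (x - i + 1)\<close>, a function in B acts modulo \<open>p\<^sup>k\<close> as an integer
  polynomial \<open>P\<close>. Bijectivity modulo \<open>p\<^sup>2\<close> says that \<open>P\<close> is injective modulo \<open>p\<close> and that \<open>P'\<close> has no zero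
  modulo \<open>p\<close>, which makes \<open>P\<close> injective modulo every \<open>p\<^sup>k\<close>. Transitivity modulo \<open>m\<close> says that the orbit of
  \<open>0\<close> returns to \<open>0\<close> modulo \<open>m\<close> exactly at the multiples of \<open>m\<close>. Write \<open>P\<^sup>i(0) = M t\<^sub>j\<close> for \<open>M = p\<^sup>n\<close> and
  \<open>i = M j\<close>; a second-order expansion of \<open>P\<^sup>M\<close> at \<open>0\<close> gives
  \<open>t\<^sub>j = c j + p (a c S\<^sub>1(j) + q c\<^sup>2 S\<^sub>2(j))\<close> modulo \<open>p\<^sup>2\<close>, where \<open>S\<^sub>1\<close> and \<open>S\<^sub>2\<close> are the sums of the numbers
  and of the squares below \<open>j\<close>. The denominators \<open>2\<close> and \<open>6\<close> of these sums are what makes the primes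
  \<open>2\<close> and \<open>3\<close> exceptional. On the measure side, the maps induced modulo \<open>p\<^sup>k\<close> describe the action on
  cylinders, and cylinders determine finite Borel measures.\<close>

section \<open>Iterates of integer polynomials modulo prime powers\<close>

text \<open>Composition with \<open>[:x, 1:]\<close> keeps integer coefficients, so the Taylor
  coefficients P'(x) and P''(x)/2 are integers.\<close>

lemma int_poly_expand:
  fixes P :: "int poly"
  obtains a b R where "\<And>h. poly P (x + h) = poly P x + a * h + b * h\<^sup>2 + h ^ 3 * poly R h"
proof -
  obtain c a b R where Q: "P \<circ>\<^sub>p [:x, 1:] = pCons c (pCons a (pCons b R))"
    by (metis pCons_cases)
  have eq: "poly P (x + h) = c + a * h + b * h\<^sup>2 + h ^ 3 * poly R h" for h
    using arg_cong[OF Q, of "\<lambda>q. poly q h"]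
    by (simp add: poly_pcompose algebra_simps power2_eq_square power3_eq_cube)
  have "poly P x = c" using eq[of 0] by simp
  then show ?thesis using that eq by metis
qed

text \<open>Once x and y agree modulo p, P(x) - P(y) is x - y times a factor congruent to P'(y)
  modulo p. If p divided P'(y), then y and y + p would collide modulo p^2; so the factor is prime to
  p and cancels.\<close>

lemma poly_inj_mod_prime_power:
  fixes P :: "int poly" and p :: int
  assumes p: "prime p"
    and inj: "\<And>x y. p dvd poly P x - poly P y \<Longrightarrow> p dvd x - y"
    and inj2: "\<And>x y. p\<^sup>2 dvd poly P x - poly P y \<Longrightarrow> p\<^sup>2 dvd x - y"
    and dvd: "p ^ k dvd poly P x - poly P y"
  shows "p ^ k dvd x - y"
proof (cases "k = 0")
  case False
  then have "p dvd poly P x - poly P y" using dvd by (meson dvd_power dvd_trans gr0I)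
  then have yx: "p dvd x - y" by (rule inj)
  obtain a b R where T: "\<And>h. poly P (y + h) = poly P y + a * h + b * h\<^sup>2 + h ^ 3 * poly R h"
    using int_poly_expand[of P y] by blast
  have a: "\<not> p dvd a"
  proof
    assume "p dvd a"
    then obtain a' where "a = p * a'" by blast
    then have "poly P (y + p) - poly P y = p\<^sup>2 * (a' + b + p * poly R p)"
      unfolding T by (simp add: algebra_simps power2_eq_square power3_eq_cube)
    then have "p\<^sup>2 dvd poly P (y + p) - poly P y" by (metis dvd_triv_left)
    then have "p\<^sup>2 dvd (y + p) - y" by (rule inj2)
    then have "p * p dvd p * 1" by (simp add: power2_eq_square)
    then have "p dvd 1" using p by (subst (asm) dvd_mult_cancel_left) auto
    then show False using p not_prime_unit by blast
  qed
  define h where "h = x - y"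
  have "poly P x - poly P y = h * (a + h * (b + h * poly R h))"
    using T[of h] by (simp add: h_def algebra_simps power2_eq_square power3_eq_cube)
  moreover have "coprime (p ^ k) (a + h * (b + h * poly R h))"
  proof -
    have "\<not> p dvd a + h * (b + h * poly R h)"
      using a yx by (simp add: h_def dvd_add_left_iff)
    then show ?thesis using p by (simp add: prime_imp_coprime)
  qed
  ultimately show ?thesis using dvd by (simp add: h_def coprime_dvd_mult_left_iff)
qed simp

text \<open>Transitivity on residues is encoded by the return times to 0, with F never reduced, so
  that one integer orbit serves all moduli p^j.\<close>

definition full_period :: "(int \<Rightarrow> int) \<Rightarrow> int \<Rightarrow> bool" where
  "full_period F m \<longleftrightarrow> (\<forall>i. m dvd (F ^^ i) 0 \<longleftrightarrow> m dvd int i)"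

lemma prime_dvd_power_self_diff:
  fixes p a :: int
  assumes "prime p"
  shows "p dvd a ^ nat p - a"
proof (cases "p dvd a")
  case True
  have "nat p > 0" using prime_gt_0_int[OF assms] by simp
  then have "p dvd a ^ nat p" using True dvd_power dvd_trans by blast
  then show ?thesis using True by (rule dvd_diff)
next
  case False
  define b where "b = nat (a mod p)"
  have p0: "p > 0" using assms by (rule prime_gt_0_int)
  then have b: "int b = a mod p" by (simp add: b_def)
  have "\<not> nat p dvd b" using False p0 b int_dvd_int_iff[of "nat p" b] by (simp add: dvd_mod_iff)
  then have "[b ^ (nat p - 1) = 1] (mod nat p)"
    using assms prime_int_nat_transfer fermat_theorem by blast
  then have "[int b ^ (nat p - 1) = 1] (mod p)"
    using p0 cong_int_iff[of "b ^ (nat p - 1)" 1 "nat p"] by simp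
  then have "[int b ^ (nat p - 1) * int b = 1 * int b] (mod p)" by (intro cong_mult cong_refl)
  then have "[int b ^ nat p = int b] (mod p)"
    using power_minus_mult[of "nat p" "int b"] p0 by simp
  moreover have "[int b = a] (mod p)" by (simp add: b)
  ultimately have "[a ^ nat p = a] (mod p)"
    using cong_pow[of "int b" a p "nat p"] by (metis cong_sym cong_trans)
  then show ?thesis by (simp add: cong_iff_dvd_diff)
qed

text \<open>Modulo \<open>p\<close> we have \<open>(a - 1) t\<^sub>j = c (a\<^sup>j - 1)\<close>, so \<open>t\<^sub>p = 0\<close> forces \<open>a\<^sup>p = 1\<close>, while \<open>a\<^sup>p = a\<close> by
  Fermat.\<close>

lemma affine_recursion_slope:
  fixes p a c :: int and t :: "nat \<Rightarrow> int"
  assumes p: "prime p" and t0: "t 0 = 0"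
    and step: "\<And>j. p dvd t (Suc j) - (c + a * t j)"
    and per: "\<And>j. p dvd t j \<longleftrightarrow> p dvd int j"
  shows "\<not> p dvd c" "p dvd a - 1"
proof -
  have "\<not> p dvd t 1" using per[of 1] p not_prime_unit by auto
  then show c: "\<not> p dvd c" using step[of 0] t0
    by (metis One_nat_def add.right_neutral dvd_diffD mult_zero_right diff_add_cancel dvd_add)
  have ind: "p dvd (a - 1) * t j - c * (a ^ j - 1)" for j
  proof (induction j)
    case (Suc j)
    have "(a - 1) * t (Suc j) - c * (a ^ Suc j - 1)
      = (a - 1) * (t (Suc j) - (c + a * t j)) + a * ((a - 1) * t j - c * (a ^ j - 1))"
      by (simp add: algebra_simps)
    then show ?case using step[of j] Suc by simp
  qed (simp add: t0)
  have "p dvd t (nat p)" using per[of "nat p"] prime_gt_0_int[OF p] by simp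
  then have "p dvd c * (a ^ nat p - 1)" using ind[of "nat p"] by (metis dvd_mult dvd_diff_right_iff)
  then have "p dvd a ^ nat p - 1" using c p by (simp add: prime_dvd_mult_iff)
  moreover have "p dvd a ^ nat p - a" using p by (rule prime_dvd_power_self_diff)
  ultimately have "p dvd (a ^ nat p - 1) - (a ^ nat p - a)" by (rule dvd_diff)
  then show "p dvd a - 1" by simp
qed

section \<open>Power sums and quadratic recursions modulo p^2\<close>

lemma two_sum_lessThan: "2 * (\<Sum>i<j. int i) = int j * (int j - 1)"
  by (induction j) (simp_all add: algebra_simps)

lemma six_sum_squares_lessThan: "6 * (\<Sum>i<j. (int i)\<^sup>2) = int j * (int j - 1) * (2 * int j - 1)"
  by (induction j) (simp_all add: algebra_simps power2_eq_square)

text \<open>Modulo p the recursion only adds c, so t_j = c j modulo p. In the terms with a factor p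
  this is precise enough modulo p^2, and summation yields the two power sums.\<close>

lemma quadratic_recursion_expand:
  fixes p a q c :: int and t :: "nat \<Rightarrow> int"
  assumes t0: "t 0 = 0"
    and step: "\<And>j. p\<^sup>2 dvd t (Suc j) - (t j + c + p * (a * t j + q * (t j)\<^sup>2))"
  shows "p\<^sup>2 dvd t j - (c * int j + p * (a * c * (\<Sum>i<j. int i) + q * c\<^sup>2 * (\<Sum>i<j. (int i)\<^sup>2)))"
proof (induction j)
  case (Suc j)
  define s1 s2 where "s1 = (\<Sum>i<j. int i)" and "s2 = (\<Sum>i<j. (int i)\<^sup>2)"
  from Suc obtain u where u: "t j = c * int j + p * (a * c * s1 + q * c\<^sup>2 * s2) + p\<^sup>2 * u"
    unfolding s1_def s2_def by (metis dvdE diff_add_cancel add.commute)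
  \<comment> \<open>\<open>v\<close> is the correction (t_j - c j) / p; under the outer factor p it
    contributes only multiples of p^2.\<close>
  define v where "v = a * c * s1 + q * c\<^sup>2 * s2 + p * u"
  have tv: "t j = c * int j + p * v" unfolding u v_def by (simp add: algebra_simps power2_eq_square)
  have "p * (a * t j + q * (t j)\<^sup>2) = p * (a * c * int j + q * c\<^sup>2 * (int j)\<^sup>2)
      + p\<^sup>2 * (a * v + q * (2 * c * int j * v + p * v\<^sup>2))"
    unfolding tv by (simp add: algebra_simps power2_eq_square)
  then have "t (Suc j) - (c * int (Suc j) + p * (a * c * (s1 + int j) + q * c\<^sup>2 * (s2 + (int j)\<^sup>2)))
    = (t (Suc j) - (t j + c + p * (a * t j + q * (t j)\<^sup>2)))
      + p\<^sup>2 * (a * v + q * (2 * c * int j * v + p * v\<^sup>2)) + p\<^sup>2 * u"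
    using u by (simp add: algebra_simps)
  moreover have "p\<^sup>2 dvd \<dots>" using step[of j] by (intro dvd_add dvd_triv_left)
  ultimately show ?case by (simp only: s1_def s2_def sum.lessThan_Suc)
qed (simp add: t0)

text \<open>For p dividing j the correction to c j vanishes modulo p^2: 2 and 6 times the power sums
  are multiples of j, and where 2 or 6 is not invertible modulo p, divisibility of \<open>a\<close>
  or \<open>q\<close> by p takes over. What remains is c j with c prime to p.\<close>

lemma quadratic_recursion_dvd_iff:
  fixes p a q c :: int and t :: "nat \<Rightarrow> int"
  assumes p: "prime p" and t0: "t 0 = 0" and c: "\<not> p dvd c"
    and step: "\<And>j. p\<^sup>2 dvd t (Suc j) - (t j + c + p * (a * t j + q * (t j)\<^sup>2))"
    and q: "p > 3 \<or> p dvd q" and a: "p \<noteq> 2 \<or> p dvd a"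
  shows "p\<^sup>2 dvd t j \<longleftrightarrow> p\<^sup>2 dvd int j"
proof -
  define s1 s2 where "s1 = (\<Sum>i<j. int i)" and "s2 = (\<Sum>i<j. (int i)\<^sup>2)"
  define w where "w = a * c * s1 + q * c\<^sup>2 * s2"
  have t: "p\<^sup>2 dvd t j - (c * int j + p * w)"
    unfolding w_def s1_def s2_def by (rule quadratic_recursion_expand[OF t0 step])
  have p2: "p \<ge> 2" using p by (simp add: prime_ge_2_int)
  have w: "p dvd w" if j: "p dvd int j"
  proof -
    have "p dvd a * s1"
    proof (cases "p = 2")
      case False
      have "p dvd 2 * s1" unfolding s1_def two_sum_lessThan using j by simp
      moreover have "\<not> p dvd 2" using False p2 by (auto dest: zdvd_imp_le)
      ultimately show ?thesis using p by (simp add: prime_dvd_mult_iff)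
    qed (use a in simp)
    moreover have "p dvd q * s2"
    proof (cases "p dvd q")
      case False
      then have p3: "p > 3" using q by simp
      have "p dvd 6 * s2" unfolding s2_def six_sum_squares_lessThan using j by simp
      moreover have "\<not> p dvd 6"
      proof
        assume "p dvd 6"
        then have "p dvd 2 * 3" by simp
        then have "p dvd 2 \<or> p dvd 3" using p prime_dvd_mult_iff by blast
        then show False using p3 by (auto dest: zdvd_imp_le)
      qed
      ultimately show ?thesis using p by (simp add: prime_dvd_mult_iff)
    qed simp
    moreover have "w = c * (a * s1) + c\<^sup>2 * (q * s2)" by (simp add: w_def algebra_simps)
    ultimately show ?thesis by simp
  qed
  have cop: "coprime (p\<^sup>2) c" using p c by (simp add: prime_imp_coprime)
  have ptop2: "p dvd p\<^sup>2" by (simp add: power2_eq_square)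
  \<comment> \<open>The correction has an explicit factor p, so reduction modulo p yields that p
    divides j; only then is the correction known to vanish modulo p^2.\<close>
  have pj: "p dvd int j" if "p\<^sup>2 dvd t j"
  proof -
    have "p\<^sup>2 dvd c * int j + p * w" using that t by (metis dvd_diff_right_iff)
    then have "p dvd c * int j" using ptop2 by (metis dvd_trans dvd_add_left_iff dvd_triv_left)
    then show ?thesis using p c by (simp add: prime_dvd_mult_iff)
  qed
  have main: "p\<^sup>2 dvd t j \<longleftrightarrow> p\<^sup>2 dvd int j" if "p dvd int j"
  proof -
    have "p\<^sup>2 dvd p * w" using w[OF that] by (simp add: power2_eq_square)
    moreover have "t j = (t j - (c * int j + p * w)) + c * int j + p * w" by simp
    ultimately have "p\<^sup>2 dvd t j \<longleftrightarrow> p\<^sup>2 dvd c * int j"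
      using t by (metis dvd_add_left_iff dvd_add_right_iff)
    then show ?thesis using cop by (simp add: coprime_dvd_mult_right_iff)
  qed
  show ?thesis using main pj ptop2 dvd_trans by blast
qed

section \<open>Expansion of iterates and the lift of full periods to p^(n + 2)\<close>

lemma poly_iterate:
  fixes P :: "int poly"
  shows "poly (((\<circ>\<^sub>p) P ^^ n) [:0, 1:]) = poly P ^^ n"
  by (induction n) (auto simp: poly_pcompose fun_eq_iff)

text \<open>By the chain rule the coefficient is H'(H(0)) H'(0). Modulo x^2, H'(x) is H'(0) plus an
  even multiple of x, so for even H(0) both factors agree modulo 4 and the product is an odd
  square.\<close>

lemma self_compose_linear_coeff_mod_4:
  fixes H :: "int poly"
  assumes "even (poly H 0)" "odd (poly.coeff (H \<circ>\<^sub>p H) 1)"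
  shows "4 dvd poly.coeff (H \<circ>\<^sub>p H) 1 - 1"
proof -
  obtain c a b R where H: "H = pCons c (pCons a (pCons b R))" by (metis pCons_cases)
  from assms(1) obtain s where s: "c = 2 * s" by (auto simp: H)
  define d where "d = poly (pderiv H) c"
  have co: "poly.coeff Q 1 = poly (pderiv Q) 0" for Q :: "int poly"
    by (simp add: poly_0_coeff_0 coeff_pderiv)
  have "poly.coeff (H \<circ>\<^sub>p H) 1 = d * a"
    unfolding co pderiv_pcompose by (simp add: poly_pcompose d_def H pderiv_pCons)
  moreover have "\<exists>e. d = a + 4 * e"
    unfolding d_def H s
    by (rule exI[of _ "b * s + 3 * s\<^sup>2 * poly R (2 * s) + 2 * s ^ 3 * poly (pderiv R) (2 * s)"])
       (simp add: pderiv_pCons algebra_simps power2_eq_square power3_eq_cube)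
  ultimately obtain e where e: "poly.coeff (H \<circ>\<^sub>p H) 1 = (a + 4 * e) * a" by blast
  then have "odd a" using assms(2) by auto
  then obtain m where "a = 2 * m + 1" by (elim oddE)
  then have "poly.coeff (H \<circ>\<^sub>p H) 1 - 1 = 4 * (m\<^sup>2 + m + e * a)"
    unfolding e by (simp add: algebra_simps power2_eq_square)
  then show ?thesis by simp
qed

text \<open>With \<open>G = P\<^sup>M\<close>, \<open>M = p\<^sup>n\<close>, the points \<open>G\<^sup>j(0) = M t\<^sub>j\<close> satisfy a recursion that modulo \<open>p\<^sup>2\<close> is
  quadratic in \<open>t\<^sub>j\<close>, affine if \<open>n \<ge> 2\<close>. For \<open>p = 2\<close> the slope \<open>G'(0)\<close> has to be \<open>1\<close> modulo \<open>4\<close>; it is,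
  because \<open>G\<close> is itself a second iterate.\<close>

lemma full_period_lift:
  fixes P :: "int poly" and p :: int
  assumes p: "prime p" and per: "\<And>j. j \<le> Suc n \<Longrightarrow> full_period (poly P) (p ^ j)"
    and n: "n \<ge> 1" "p \<le> 3 \<Longrightarrow> n \<ge> 2"
  shows "full_period (poly P) (p ^ (n + 2))"
proof -
  define M M' N where "M = p ^ n" and "M' = p ^ (n - 1)" and "N = nat M"
  have p0: "p > 0" using p by (rule prime_gt_0_int)
  have M0: "M > 0" using p0 by (simp add: M_def)
  have N: "int N = M" using M0 by (simp add: N_def)
  have M': "M = p * M'" using n(1) by (simp add: M_def M'_def power_eq_if)
  define y where "y j = (poly P ^^ (N * j)) 0" for j
  define t where "t j = y j div M" for j
  \<comment> \<open>The division by \<open>M\<close> is exact: the full period modulo p^n applies to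
    the multiples N j of M.\<close>
  have Mt: "y j = M * t j" for j
    using per[of n] by (simp add: full_period_def y_def t_def flip: M_def N)
  have dvd_iff: "p ^ (n + m) dvd y j \<longleftrightarrow> p ^ m dvd t j" for m j
    using M0 by (simp add: Mt power_add flip: M_def)
  have dvd_iff': "p ^ (n + m) dvd int (N * j) \<longleftrightarrow> p ^ m dvd int j" for m j
    using M0 by (simp add: N power_add flip: M_def)
  define G where "G = ((\<circ>\<^sub>p) P ^^ N) [:0, 1:]"
  have G: "poly G = poly P ^^ N" by (simp add: G_def poly_iterate)
  obtain c0 a1 b R where Gp: "G = pCons c0 (pCons a1 (pCons b R))" by (metis pCons_cases)
  define c where "c = t 1"
  have "poly G 0 = M * c" using Mt[of 1] by (simp add: G y_def c_def)
  then have c0: "c0 = M * c" by (simp add: Gp)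
  have ySuc: "y (Suc j) = poly G (y j)" for j
    by (simp add: G y_def funpow_add)
  \<comment> \<open>Expanding G(M t) and cancelling one factor M leaves M at the quadratic term and
    M^2 at the rest.\<close>
  have tSuc: "t (Suc j) = c + a1 * t j + M * b * (t j)\<^sup>2 + M\<^sup>2 * (t j ^ 3 * poly R (y j))" for j
  proof -
    have "M * t (Suc j) = c0 + y j * (a1 + y j * (b + y j * poly R (y j)))"
      using ySuc[of j] Mt[of "Suc j"] by (simp add: Gp)
    also have "\<dots> = M * (c + a1 * t j + M * b * (t j)\<^sup>2 + M\<^sup>2 * (t j ^ 3 * poly R (y j)))"
      using Mt[of j] c0 by (simp add: algebra_simps power2_eq_square power3_eq_cube)
    finally show ?thesis using M0 by simp
  qed
  have t0: "t 0 = 0" using Mt[of 0] M0 by (simp add: y_def)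
  \<comment> \<open>This is the full period modulo p^(n + 1), divided by \<open>M\<close>.\<close>
  have tper: "p dvd t j \<longleftrightarrow> p dvd int j" for j
    using per[of "n + 1"] dvd_iff[of 1 j] dvd_iff'[of 1 j] by (simp add: full_period_def y_def)
  have lin: "p dvd t (Suc j) - (c + a1 * t j)" for j
    unfolding tSuc by (simp add: M' power2_eq_square)
  have c: "\<not> p dvd c" and a1: "p dvd a1 - 1"
    using affine_recursion_slope[OF p t0 lin tper] by auto
  then obtain a where a: "a1 = 1 + p * a" by (metis dvdE diff_add_cancel add.commute)
  have "p = 2 \<Longrightarrow> p dvd a"
  proof -
    assume p2: "p = 2"
    then have n2: "n \<ge> 2" using n(2) by simp
    \<comment> \<open>H is P iterated N/2 times. As n \<ge> 2, also N/2 is even, and the period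
      modulo 2 makes H(0) even.\<close>
    define N' where "N' = nat M'"
    have N': "int N' = M'" using p0 by (simp add: N'_def M'_def)
    have NN': "N = N' + N'" using N N' M' p2 by (simp flip: of_nat_eq_iff[where 'a = int])
    define H where "H = ((\<circ>\<^sub>p) P ^^ N') [:0, 1:]"
    have H: "poly H = poly P ^^ N'" by (simp add: H_def poly_iterate)
    have "poly G = poly (H \<circ>\<^sub>p H)"
      by (simp add: G H NN' funpow_add poly_pcompose fun_eq_iff)
    then have GH: "G = H \<circ>\<^sub>p H" by (simp add: poly_eq_poly_eq_iff)
    have "p dvd int N'" using n2 unfolding N' M'_def by simp
    then have "even (poly H 0)" using per[of 1] n p2 by (simp add: full_period_def H)
    moreover have "poly.coeff (H \<circ>\<^sub>p H) 1 = a1" by (simp add: Gp flip: GH)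
    moreover have "odd a1" using a p2 by simp
    ultimately have "4 dvd a1 - 1" using self_compose_linear_coeff_mod_4[of H] by simp
    then have "2 * 2 dvd 2 * a" using a p2 by simp
    then show ?thesis unfolding p2 by (subst (asm) dvd_mult_cancel_left) simp
  qed
  \<comment> \<open>The quadratic coefficient contains M' = p^(n - 1), a multiple of p as soon as n
    \<ge> 2; this is where p = 3 needs the larger n.\<close>
  moreover have "p > 3 \<or> p dvd M' * b"
    using n(2) by (cases "p > 3") (auto simp: M'_def)
  moreover have "p\<^sup>2 dvd t (Suc j) - (t j + c + p * (a * t j + (M' * b) * (t j)\<^sup>2))" for j
  proof -
    have "t (Suc j) - (t j + c + p * (a * t j + (M' * b) * (t j)\<^sup>2))
      = p\<^sup>2 * (M'\<^sup>2 * (t j ^ 3 * poly R (y j)))"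
      unfolding tSuc a M' by (simp add: algebra_simps power2_eq_square)
    then show ?thesis by simp
  qed
  ultimately have iff: "p\<^sup>2 dvd t j \<longleftrightarrow> p\<^sup>2 dvd int j" for j
    using quadratic_recursion_dvd_iff[of p t c a "M' * b"] p t0 c by blast
  have "p ^ (n + 2) dvd (poly P ^^ i) 0 \<longleftrightarrow> p ^ (n + 2) dvd int i" for i
  proof (cases "M dvd int i")
    case True
    then have "N dvd i" by (simp flip: N)
    then obtain j where "i = N * j" by blast
    then show ?thesis using dvd_iff[of 2 j] dvd_iff'[of 2 j] iff[of j] by (simp add: y_def)
  next
    case False
    have "M dvd p ^ (n + 2)" by (simp add: M_def power_add)
    moreover have "\<not> M dvd (poly P ^^ i) 0"
      using False per[of n] by (simp add: full_period_def M_def)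
    ultimately show ?thesis using False dvd_trans by blast
  qed
  then show ?thesis by (simp add: full_period_def)
qed

text \<open>For k > m the lift is applied with n = k - 2. Then m \<ge> 2 gives n \<ge> 1, and m
  \<ge> 3 gives the n \<ge> 2 demanded for p \<le> 3.\<close>

lemma full_period_all_powers:
  fixes P :: "int poly" and p :: int
  assumes p: "prime p" and per: "\<And>j. j \<le> m \<Longrightarrow> full_period (poly P) (p ^ j)"
    and m: "m \<ge> 2" "p \<le> 3 \<Longrightarrow> m \<ge> 3"
  shows "full_period (poly P) (p ^ k)"
proof (induction k rule: less_induct)
  case (less k)
  show ?case
  proof (cases "k \<le> m")
    case False
    then obtain n where k: "k = n + 2" using m(1) by (metis le_iff_add add.commute nat_le_linear order_trans)
    show ?thesis unfolding k
      using less.IH m False k by (intro full_period_lift[OF p]) auto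
  qed (rule per)
qed

section \<open>The class B modulo prime powers\<close>

lemma padic_residue_sum:
  "padic_residue (sum f A :: 'p :: prime_card padic_int) k
    = (\<Sum>i\<in>A. padic_residue (f i) k) mod int CARD('p) ^ k"
  by (induction A rule: infinite_finite_induct) (simp_all add: padic_residue_simps mod_simps)

lemma padic_residue_prod:
  "padic_residue (prod f A :: 'p :: prime_card padic_int) k
    = (\<Prod>i\<in>A. padic_residue (f i) k) mod int CARD('p) ^ k"
  by (induction A rule: infinite_finite_induct) (simp_all add: padic_residue_simps mod_simps)

text \<open>\<open>X\<close> may be any integer in the class of x, in particular a residue of x of
  higher precision.\<close>

lemma padic_residue_falling:
  fixes x :: "'p :: prime_card padic_int"
  assumes "[X = padic_residue x k] (mod int CARD('p) ^ k)"
  shows "padic_residue (\<Prod>j=0..<i. x - of_nat j) k = (\<Prod>j=0..<i. X - int j) mod int CARD('p) ^ k"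
proof -
  have "[(\<Prod>j=0..<i. padic_residue (x - of_nat j) k) = (\<Prod>j=0..<i. X - int j)] (mod int CARD('p) ^ k)"
    using assms
    by (intro cong_prod) (auto simp: padic_residue_simps padic_residue_of_nat mod_simps cong_def
        intro: mod_diff_cong)
  then show ?thesis unfolding padic_residue_prod by (simp add: cong_def)
qed

lemma prod_diff_cong_int:
  fixes X Y m :: int
  assumes "[X = Y] (mod m)"
  shows "[(\<Prod>j=0..<i. X - int j) = (\<Prod>j=0..<i. Y - int j)] (mod m)"
  using assms by (intro cong_prod cong_diff cong_refl)

lemma fact_dvd_int_falling: "fact i dvd (\<Prod>j=0..<i. X - int j)"
  unfolding falling_fact_pochhammer' by (rule fact_dvd_pochhammer)

text \<open>If p^v is the p-part of i!, division by i! costs v digits: the integer quotient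
  \<open>C X\<close> modulo p^k depends only on X modulo p^(k + v). Hence the quotients at the
  residues of x are coherent and define a p-adic integer.\<close>

lemma fact_dvd_padic_falling:
  fixes x :: "'p :: prime_card padic_int"
  shows "fact i dvd (\<Prod>j=0..<i. x - of_nat j)"
proof -
  let ?p = "int CARD('p)"
  have p: "prime ?p" by (rule prime_card_int)
  obtain v m where vm: "fact i = ?p ^ v * m" "\<not> ?p dvd m"
    using multiplicity_decompose'[of "fact i :: int" ?p] p by (metis fact_nonzero not_prime_unit)
  define C where "C X = (\<Prod>j=0..<i. X - int j) div fact i" for X
  have C: "fact i * C X = (\<Prod>j=0..<i. X - int j)" for X
    by (simp add: C_def fact_dvd_int_falling)
  define z where "z k = C (padic_residue x (k + v)) mod ?p ^ k" for k
  have coh: "[C X = C Y] (mod ?p ^ k)" if "[X = Y] (mod ?p ^ (k + v))" for X Y k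
  proof -
    have "[fact i * C X = fact i * C Y] (mod ?p ^ (k + v))"
      unfolding C by (rule prod_diff_cong_int[OF that])
    then have "?p ^ v * ?p ^ k dvd ?p ^ v * (m * (C X - C Y))"
      unfolding vm cong_iff_dvd_diff by (simp add: power_add algebra_simps)
    then have "?p ^ k dvd m * (C X - C Y)"
      using p_pow_pos[where 'p = 'p, of v] by (subst (asm) dvd_mult_cancel_left) auto
    moreover have "coprime (?p ^ k) m" using p vm(2) by (simp add: prime_imp_coprime)
    ultimately show ?thesis by (simp add: cong_iff_dvd_diff coprime_dvd_mult_right_iff)
  qed
  have "z k \<in> {0..<?p ^ k} \<and> z (Suc k) mod ?p ^ k = z k" for k
  proof -
    have "[padic_residue x (Suc k + v) = padic_residue x (k + v)] (mod ?p ^ (k + v))"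
      using padic_residue_mod[of "k + v" "Suc k + v" x] by (simp add: cong_def)
    from coh[OF this] show ?thesis by (simp add: z_def cong_def mod_Suc_pow_mod)
  qed
  then have res: "padic_residue (Abs_padic_int z :: 'p padic_int) k = z k" for k
    by (subst Abs_padic_int_inverse) auto
  have "(\<Prod>j=0..<i. x - of_nat j) = fact i * Abs_padic_int z"
  proof (rule padic_eqI)
    fix k
    have "[padic_residue x (k + v) = padic_residue x k] (mod ?p ^ k)"
      using padic_residue_mod[of k "k + v" x] by (simp add: cong_def)
    then have "padic_residue (\<Prod>j=0..<i. x - of_nat j) k
        = (fact i * C (padic_residue x (k + v))) mod ?p ^ k"
      unfolding C by (rule padic_residue_falling)
    moreover have "padic_residue (fact i :: 'p padic_int) k = fact i mod ?p ^ k"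
      using padic_residue_of_nat[of "fact i" k, where 'p = 'p] by simp
    ultimately show "padic_residue (\<Prod>j=0..<i. x - of_nat j) k
        = padic_residue (fact i * Abs_padic_int z :: 'p padic_int) k"
      by (simp add: padic_residue_simps res z_def mod_simps)
  qed
  then show ?thesis by simp
qed

text \<open>The factor i! of the coefficient cancels the denominator of the binomial. The remaining
  falling factorial vanishes modulo p^k for i \<ge> p^k, since p^k divides i!, so modulo p^k the
  series is a finite sum.\<close>

lemma padic_B_poly_mod:
  fixes f :: "'p :: prime_card padic_int \<Rightarrow> 'p padic_int"
  assumes "f \<in> padic_B"
  shows "\<exists>P. \<forall>x. padic_residue (f x) k = poly P (padic_residue x k) mod int CARD('p) ^ k"
proof -
  let ?p = "int CARD('p)"
  obtain a where a: "\<And>i. fact i dvd a i" and sums: "\<And>x. (\<lambda>i. a i * padic_binom x i) sums f x"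
    using assms by (auto simp: padic_B_def)
  obtain b where b: "\<And>i. a i = fact i * b i" using a unfolding dvd_def by metis
  have summand: "a i * padic_binom x i = b i * (\<Prod>j=0..<i. x - of_nat j)" for i x
    using fact_dvd_padic_falling[of i x] by (simp add: b padic_binom_def mult.commute mult.left_commute)
  define N where "N = CARD('p) ^ k"
  define P where "P = (\<Sum>i<N. Polynomial.smult (padic_residue (b i) k) (\<Prod>j=0..<i. [:- int j, 1:]))"
  have "padic_residue (f x) k = poly P (padic_residue x k) mod ?p ^ k" for x
  proof -
    have zero: "padic_residue (\<Prod>j=0..<i. x - of_nat j) k = 0" if "i \<ge> N" for i
    proof -
      have "N dvd fact i" using that p_gt_1[where 'p = 'p] by (intro dvd_fact) (simp_all add: N_def)
      then have "?p ^ k dvd fact i" unfolding N_def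
        by (metis int_dvd_int_iff of_nat_fact of_nat_power)
      moreover have "fact i dvd (\<Prod>j=0..<i. padic_residue x k - int j)"
        by (rule fact_dvd_int_falling)
      ultimately show ?thesis
        by (subst padic_residue_falling[of "padic_residue x k"]) (auto intro: dvd_trans)
    qed
    have part: "padic_residue (\<Sum>i<n. a i * padic_binom x i) k = poly P (padic_residue x k) mod ?p ^ k"
      if n: "n \<ge> N" for n
    proof -
      have "padic_residue (\<Sum>i<n. a i * padic_binom x i) k
          = (\<Sum>i<n. padic_residue (b i * (\<Prod>j=0..<i. x - of_nat j)) k) mod ?p ^ k"
        by (simp add: summand padic_residue_sum)
      also have "(\<Sum>i<n. padic_residue (b i * (\<Prod>j=0..<i. x - of_nat j)) k)
          = (\<Sum>i<N. padic_residue (b i * (\<Prod>j=0..<i. x - of_nat j)) k)"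
        using n zero by (intro sum.mono_neutral_right) (auto simp: times_padic_int.rep_eq)
      also have "\<dots> mod ?p ^ k = (\<Sum>i<N. padic_residue (b i) k * (\<Prod>j=0..<i. padic_residue x k - int j)) mod ?p ^ k"
        by (simp add: times_padic_int.rep_eq padic_residue_falling[of "padic_residue x k"]
            mod_sum_eq mod_mult_right_eq)
      also have "\<dots> = poly P (padic_residue x k) mod ?p ^ k"
        by (simp add: P_def poly_sum poly_prod)
      finally show ?thesis .
    qed
    \<comment> \<open>A distance below p^(-k) forces equal residues, so a late partial sum already
      has the residue of f(x).\<close>
    have "1 / real CARD('p) ^ k > 0" using p_gt_1[where 'p = 'p] by simp
    then have "eventually (\<lambda>n. dist (\<Sum>i<n. a i * padic_binom x i) (f x) < 1 / real CARD('p) ^ k) sequentially"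
      using sums[of x] unfolding sums_def by (rule tendstoD[rotated])
    then obtain n where "n \<ge> N" "dist (\<Sum>i<n. a i * padic_binom x i) (f x) < 1 / real CARD('p) ^ k"
      unfolding eventually_sequentially by (meson nat_le_linear order_refl order_trans)
    then show ?thesis using part[of n] padic_dist_le_iff[of "\<Sum>i<n. a i * padic_binom x i" "f x" k] by simp
  qed
  then show ?thesis by blast
qed

section \<open>Haar measure and residues\<close>

lemma sets_padic_haar [simp, measurable_cong]: "sets (padic_haar :: 'p :: prime_card padic_int measure) = sets borel"
  using normalized_haar_padic_haar[where 'a = 'p] by (simp add: normalized_haar_def)

lemma space_padic_haar [simp]: "space (padic_haar :: 'p :: prime_card padic_int measure) = UNIV"
  using sets_eq_imp_space_eq[OF sets_padic_haar[where 'p = 'p]] by simp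

lemma prob_space_padic_haar: "prob_space (padic_haar :: 'p :: prime_card padic_int measure)"
  using normalized_haar_padic_haar[where 'a = 'p] by (intro prob_spaceI) (simp add: normalized_haar_def)

lemma measure_padic_cyl:
  assumes "r \<in> {0..<int CARD('p :: prime_card) ^ k}"
  shows "measure padic_haar (padic_cyl k r :: 'p padic_int set) = 1 / real (CARD('p) ^ k)"
proof -
  have "emeasure padic_haar (padic_cyl k r :: 'p padic_int set) = ennreal (1 / real (CARD('p) ^ k))"
    using haar_cyl[OF normalized_haar_padic_haar assms] p_gt_1[where 'p = 'p]
    by (simp add: divide_ennreal[symmetric] ennreal_of_nat_eq_real_of_nat)
  then show ?thesis by (simp add: measure_def)
qed

lemma padic_residue_of_int_self:
  assumes "r \<in> {0..<int CARD('p :: prime_card) ^ k}"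
  shows "padic_residue (of_int r :: 'p padic_int) k = r"
  using assms by (simp add: padic_residue_of_int)

lemma induces_mod_closed:
  fixes f :: "'p :: prime_card padic_int \<Rightarrow> 'p padic_int"
  assumes "induces_mod f k g" "r \<in> {0..<int CARD('p) ^ k}"
  shows "g r \<in> {0..<int CARD('p) ^ k}"
proof -
  have "g r = padic_residue (f (of_int r)) k"
    using assms by (simp add: induces_mod_def padic_residue_of_int_self)
  then show ?thesis using padic_residue_bounds[where 'p = 'p] by simp
qed

lemma vimage_padic_cyl:
  fixes f :: "'p :: prime_card padic_int \<Rightarrow> 'p padic_int"
  assumes "induces_mod f k g" "inj_on g {0..<int CARD('p) ^ k}" "s \<in> {0..<int CARD('p) ^ k}"
  shows "f -` padic_cyl k (g s) = padic_cyl k s"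
proof -
  have "g (padic_residue x k) = g s \<longleftrightarrow> padic_residue x k = s" for x :: "'p padic_int"
    using assms padic_residue_bounds[of x k] by (intro inj_on_eq_iff) auto
  then show ?thesis using assms(1) by (auto simp: padic_cyl_def induces_mod_def)
qed

text \<open>Preimages of cylinders are cylinders of the same level, so the image of Haar measure
  agrees with it on cylinders and therefore everywhere.\<close>

lemma measure_preserving_if_bijective_mod:
  fixes f :: "'p :: prime_card padic_int \<Rightarrow> 'p padic_int"
  assumes "\<And>k. bijective_mod f k"
  shows "measure_preserving f"
proof -
  have pre: "\<exists>s\<in>{0..<int CARD('p) ^ k}. f -` padic_cyl k r = padic_cyl k s"
    if "r \<in> {0..<int CARD('p) ^ k}" for k r
  proof -
    obtain g where g: "induces_mod f k g" "bij_betw g {0..<int CARD('p) ^ k} {0..<int CARD('p) ^ k}"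
      using assms by (auto simp: bijective_mod_def)
    have "r \<in> g ` {0..<int CARD('p) ^ k}" using that bij_betw_imp_surj_on[OF g(2)] by simp
    then obtain s where s: "s \<in> {0..<int CARD('p) ^ k}" "r = g s" by (elim imageE)
    then show ?thesis using vimage_padic_cyl[OF g(1), of s] g(2) by (auto simp: bij_betw_def)
  qed
  have "f \<in> measurable borel borel"
  proof (rule measurable_sigma_sets[where \<Omega> = UNIV and A = padic_cyls])
    fix y :: "'p padic_int set"
    assume "y \<in> padic_cyls"
    then obtain k r where y: "y = padic_cyl k r" by auto
    show "f -` y \<inter> space borel \<in> sets borel"
      using pre[of r k] padic_cyl_out[of r k, where 'p = 'p] y
      by (cases "r \<in> {0..<int CARD('p) ^ k}") auto
  qed (simp_all add: sets_borel_padic)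
  then have f: "f \<in> measurable padic_haar padic_haar"
    by (simp cong: measurable_cong_sets)
  have "distr padic_haar padic_haar f = padic_haar"
  proof (rule padic_measure_eqI)
    show "emeasure (distr padic_haar padic_haar f) UNIV \<noteq> \<infinity>"
      using f prob_space.emeasure_space_1[OF prob_space_padic_haar[where 'p = 'p]]
      by (simp add: emeasure_distr)
    fix k r assume r: "r \<in> {0..<int CARD('p) ^ k}"
    then show "emeasure (distr padic_haar padic_haar f) (padic_cyl k r)
        = emeasure padic_haar (padic_cyl k r :: 'p padic_int set)"
      using pre[OF r] f
      by (auto simp: emeasure_distr haar_cyl[OF normalized_haar_padic_haar])
  qed simp_all
  then have "measure padic_haar (f -` U) = measure padic_haar U" if "U \<in> sets padic_haar" for U
    using measure_distr[OF f that] by simp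
  then show ?thesis using f by (simp add: measure_preserving_def)
qed

text \<open>A cylinder has positive measure, so its preimage is nonempty; thus g is surjective on a
  finite set.\<close>

lemma measure_preserving_imp_bij_betw:
  fixes f :: "'p :: prime_card padic_int \<Rightarrow> 'p padic_int"
  assumes f: "measure_preserving f" and g: "induces_mod f k g"
  shows "bij_betw g {0..<int CARD('p) ^ k} {0..<int CARD('p) ^ k}"
proof -
  let ?S = "{0..<int CARD('p) ^ k}"
  have "?S \<subseteq> g ` ?S"
  proof
    fix r assume r: "r \<in> ?S"
    have "measure padic_haar (f -` padic_cyl k r) = 1 / real (CARD('p) ^ k)"
      using f measure_padic_cyl[OF r] by (simp add: measure_preserving_def)
    then have "f -` padic_cyl k r \<noteq> {}" by auto
    then obtain x where "padic_residue (f x) k = r" by (auto simp: padic_cyl_def)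
    then show "r \<in> g ` ?S" using g padic_residue_bounds[of x k] by (auto simp: induces_mod_def)
  qed
  then have "g ` ?S = ?S" using induces_mod_closed[OF g] by blast
  then show ?thesis by (simp add: bij_betw_def eq_card_imp_inj_on)
qed

text \<open>The points with residue in the orbit of 0 form an invariant set of positive measure,
  hence of measure 1. A missed residue would contribute a disjoint cylinder of positive
  measure.\<close>

lemma ergodic_imp_cyclic_on:
  fixes f :: "'p :: prime_card padic_int \<Rightarrow> 'p padic_int"
  assumes f: "ergodic f" and g: "induces_mod f k g"
  shows "cyclic_on g {0..<int CARD('p) ^ k}"
proof -
  interpret prob_space "padic_haar :: 'p padic_int measure" by (rule prob_space_padic_haar)
  let ?S = "{0..<int CARD('p) ^ k}"
  \<comment> \<open>\<open>orbit\<close> starts with g(0); that 0 itself lies in \<open>T\<close>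
    follows only once \<open>T\<close> is all of \<open>?S\<close>.\<close>
  define T where "T = orbit g 0"
  have bij: "bij_betw g ?S ?S"
    using f g by (intro measure_preserving_imp_bij_betw) (simp_all add: ergodic_def)
  have zero: "0 \<in> ?S" by simp
  have "r \<in> ?S" if "r \<in> T" for r
    using that unfolding T_def by induction (use induces_mod_closed[OF g] zero in blast)+
  then have TS: "T \<subseteq> ?S" by blast
  have gT: "g ` T \<subseteq> T" by (auto simp: T_def intro: orbit.step)
  have "g ` T = T"
    using TS gT bij by (intro endo_inj_surj) (auto simp: bij_betw_def intro: finite_subset inj_on_subset)
  \<comment> \<open>Injectivity keeps residues outside \<open>T\<close> outside, so \<open>U\<close>
    equals its full preimage.\<close>
  then have gT_iff: "g r \<in> T \<longleftrightarrow> r \<in> T" if "r \<in> ?S" for r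
    using that TS bij unfolding bij_betw_def by (metis (no_types, lifting) inj_on_image_mem_iff)
  define U where "U = {x :: 'p padic_int. padic_residue x k \<in> T}"
  have "U = (\<Union>r\<in>T. padic_cyl k r)" by (auto simp: U_def padic_cyl_def)
  moreover have "countable T" using TS by (meson countable_finite finite_atLeastLessThan_int finite_subset)
  ultimately have Us: "U \<in> sets borel" by auto
  have "padic_residue x k \<in> ?S" for x :: "'p padic_int" using padic_residue_bounds[of x k] by simp
  then have "f -` U = U" using g gT_iff by (auto simp: U_def induces_mod_def)
  then have U01: "prob U \<in> {0, 1}" using f Us by (simp add: ergodic_def)
  have pos: "1 / real (CARD('p) ^ k) > 0" using p_gt_1[where 'p = 'p] by simp
  have "g 0 \<in> T" by (simp add: T_def orbit.base)
  then have "prob (padic_cyl k (g 0)) \<le> prob U"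
    using Us by (intro finite_measure_mono) (auto simp: U_def padic_cyl_def)
  then have "prob U > 0"
    using pos measure_padic_cyl[OF subsetD[OF TS \<open>g 0 \<in> T\<close>]] by linarith
  then have U1: "prob U = 1" using U01 by simp
  have "?S \<subseteq> T"
  proof
    fix r assume r: "r \<in> ?S"
    show "r \<in> T"
    proof (rule ccontr)
      assume "r \<notin> T"
      then have "U \<inter> padic_cyl k r = {}" by (auto simp: U_def padic_cyl_def)
      then have "prob (U \<union> padic_cyl k r) = prob U + prob (padic_cyl k r)"
        using Us by (intro finite_measure_Union) auto
      then show False using U1 pos measure_padic_cyl[OF r] prob_le_1[of "U \<union> padic_cyl k r"] by linarith
    qed
  qed
  then show ?thesis using TS zero by (auto simp: cyclic_on_def T_def)
qed

text \<open>An invariant set meets all cylinders of a given level in the same measure; hence it is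
  independent of every cylinder, and so of itself.\<close>

lemma ergodic_if_transitive_mod:
  fixes f :: "'p :: prime_card padic_int \<Rightarrow> 'p padic_int"
  assumes tr: "\<And>k. transitive_mod f k"
  shows "ergodic f"
proof -
  interpret prob_space "padic_haar :: 'p padic_int measure" by (rule prob_space_padic_haar)
  have mp: "measure_preserving f"
    using tr by (intro measure_preserving_if_bijective_mod) (auto simp: transitive_mod_def bijective_mod_def)
  have "prob U \<in> {0, 1}" if Us: "U \<in> sets padic_haar" and inv: "f -` U = U" for U
  proof -
    have eq: "prob (U \<inter> padic_cyl k r) = prob U / real (CARD('p) ^ k)"
      if r: "r \<in> {0..<int CARD('p) ^ k}" for k r
    proof -
      let ?S = "{0..<int CARD('p) ^ k}"
      obtain g where g: "induces_mod f k g" "bij_betw g ?S ?S" "cyclic_on g ?S"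
        using tr by (auto simp: transitive_mod_def)
      \<comment> \<open>Invariance turns the preimage of a piece of \<open>U\<close> into the piece
        over the preceding residue; around the cycle all pieces have equal measure.\<close>
      have shift: "prob (U \<inter> padic_cyl k (g s)) = prob (U \<inter> padic_cyl k s)" if s: "s \<in> ?S" for s
      proof -
        have "f -` (U \<inter> padic_cyl k (g s)) = U \<inter> padic_cyl k s"
          using vimage_padic_cyl[OF g(1) _ s] g(2) inv by (simp add: vimage_Int bij_betw_def)
        then show ?thesis using mp Us unfolding measure_preserving_def
          by (metis padic_cyl_borel sets.Int sets_padic_haar)
      qed
      have const: "prob (U \<inter> padic_cyl k s) = prob (U \<inter> padic_cyl k r)" if "s \<in> ?S" for s
      proof -
        have orb: "?S = orbit g r" using g(3) r by (auto simp: cyclic_on_alldef)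
        have "s \<in> orbit g r" using that orb by simp
        then show ?thesis
        proof induction
          case base
          then show ?case using shift[OF r] .
        next
          case (step y)
          then show ?case using shift[of y] orb by simp
        qed
      qed
      have "U = (\<Union>s\<in>?S. U \<inter> padic_cyl k s)"
        using padic_residue_bounds[where 'p = 'p] by (auto simp: padic_cyl_def)
      then have "prob U = prob (\<Union>s\<in>?S. U \<inter> padic_cyl k s)" by simp
      also have "\<dots> = (\<Sum>s\<in>?S. prob (U \<inter> padic_cyl k s))"
      proof (rule finite_measure_finite_Union)
        show "disjoint_family_on (\<lambda>s. U \<inter> padic_cyl k s) ?S"
          by (auto simp: disjoint_family_on_def padic_cyl_def)
      qed (use Us in auto)
      also have "\<dots> = (\<Sum>s\<in>?S. prob (U \<inter> padic_cyl k r))" by (intro sum.cong refl const)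
      also have "\<dots> = real (CARD('p) ^ k) * prob (U \<inter> padic_cyl k r)"
        by (simp add: nat_power_eq)
      finally show ?thesis using p_gt_1[where 'p = 'p] by simp
    qed
    \<comment> \<open>The measures A \<mapsto> mu(U \<inter> A) and A \<mapsto> mu(U) mu(A) agree on
      cylinders, hence on all Borel sets; A = U gives mu(U) = mu(U)^2.\<close>
    define N where "N = density padic_haar (indicator U)"
    define N' where "N' = scale_measure (emeasure padic_haar U) (padic_haar :: 'p padic_int measure)"
    have N: "emeasure N A = emeasure padic_haar (U \<inter> A)" if "A \<in> sets borel" for A
      unfolding N_def using that Us by (subst emeasure_restricted) auto
    have "N = N'"
    proof (rule padic_measure_eqI)
      show "emeasure N UNIV \<noteq> \<infinity>" by (simp add: N)
      fix k r assume r: "r \<in> {0..<int CARD('p) ^ k}"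
      have "emeasure N (padic_cyl k r) = ennreal (prob U * (1 / real (CARD('p) ^ k)))"
        using eq[OF r] by (simp add: N emeasure_eq_measure)
      also have "\<dots> = emeasure N' (padic_cyl k r)"
        unfolding N'_def emeasure_scale_measure emeasure_eq_measure measure_padic_cyl[OF r]
        by (rule ennreal_mult) auto
      finally show "emeasure N (padic_cyl k r) = emeasure N' (padic_cyl k r)" .
    qed (simp_all add: N_def N'_def)
    then have "emeasure N U = emeasure N' U" by simp
    then have "ennreal (prob U) = ennreal (prob U * prob U)"
      using Us by (simp add: N N'_def emeasure_eq_measure ennreal_mult)
    then have "prob U = prob U * prob U" by (subst (asm) ennreal_inj) auto
    then show ?thesis by simp
  qed
  then show ?thesis using mp by (simp add: ergodic_def)
qed

section \<open>Periods and bijectivity modulo m\<close>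

lemma poly_diff_dvd:
  fixes P :: "int poly"
  assumes "m dvd x - y"
  shows "m dvd poly P x - poly P y"
proof -
  obtain a b R where "\<And>h. poly P (y + h) = poly P y + a * h + b * h\<^sup>2 + h ^ 3 * poly R h"
    using int_poly_expand[of P y] by blast
  from this[of "x - y"] have "poly P x - poly P y = (x - y) * (a + b * (x - y) + (x - y)\<^sup>2 * poly R (x - y))"
    by (simp add: algebra_simps power2_eq_square power3_eq_cube)
  then show ?thesis using assms by simp
qed

lemma poly_mod_cong:
  fixes P :: "int poly"
  shows "x mod m = y mod m \<Longrightarrow> poly P x mod m = poly P y mod m"
  unfolding mod_eq_dvd_iff by (rule poly_diff_dvd)

section \<open>Integer maps compatible with a fixed modulus\<close>

context
  fixes F :: "int \<Rightarrow> int" and m :: int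
  assumes compat: "\<And>x y. m dvd x - y \<Longrightarrow> m dvd F x - F y" and m: "m > 0"
begin

text \<open>The left side avoids representatives, so that different moduli can be compared for the
  same F.\<close>

lemma inj_mod_iff_bij_betw:
  "(\<forall>x y. m dvd F x - F y \<longrightarrow> m dvd x - y) \<longleftrightarrow> bij_betw (\<lambda>r. F r mod m) {0..<m} {0..<m}"
proof
  assume inj: "\<forall>x y. m dvd F x - F y \<longrightarrow> m dvd x - y"
  have "inj_on (\<lambda>r. F r mod m) {0..<m}"
  proof (rule inj_onI)
    fix x y assume xy: "x \<in> {0..<m}" "y \<in> {0..<m}" and "F x mod m = F y mod m"
    then have "m dvd x - y" using inj unfolding mod_eq_dvd_iff by blast
    then have "x mod m = y mod m" unfolding mod_eq_dvd_iff .
    then show "x = y" using xy by simp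
  qed
  then show "bij_betw (\<lambda>r. F r mod m) {0..<m} {0..<m}"
    unfolding bij_betw_def using m by (simp add: endo_inj_surj image_subset_iff)
next
  assume "bij_betw (\<lambda>r. F r mod m) {0..<m} {0..<m}"
  then have inj: "inj_on (\<lambda>r. F r mod m) {0..<m}" by (simp add: bij_betw_def)
  have F: "F (x mod m) mod m = F x mod m" for x
    unfolding mod_eq_dvd_iff by (rule compat) (simp flip: mod_eq_dvd_iff)
  show "\<forall>x y. m dvd F x - F y \<longrightarrow> m dvd x - y"
  proof (intro allI impI)
    fix x y assume "m dvd F x - F y"
    then have "F (x mod m) mod m = F (y mod m) mod m" unfolding F mod_eq_dvd_iff .
    then have "x mod m = y mod m" using inj m by (elim inj_onD) auto
    then show "m dvd x - y" unfolding mod_eq_dvd_iff .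
  qed
qed

lemma funpow_diff_dvd: "m dvd x - y \<Longrightarrow> m dvd (F ^^ i) x - (F ^^ i) y"
  by (induction i) (auto intro: compat)

lemma inj_on_orbit_mod:
  assumes iff: "\<And>i. m dvd (F ^^ i) 0 \<longleftrightarrow> L dvd i"
  shows "inj_on (\<lambda>i. (F ^^ i) 0 mod m) {..<L}"
proof (rule linorder_inj_onI)
  fix i j assume ij: "i < j" "i \<in> {..<L}" "j \<in> {..<L}"
  show "(F ^^ i) 0 mod m \<noteq> (F ^^ j) 0 mod m"
  proof
    assume "(F ^^ i) 0 mod m = (F ^^ j) 0 mod m"
    then have "m dvd (F ^^ i) 0 - (F ^^ j) 0" unfolding mod_eq_dvd_iff .
    \<comment> \<open>Running L - j further steps moves j to the return time L, so 0 would recur at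
      L - j + i, strictly between 0 and L.\<close>
    then have "m dvd (F ^^ (L - j)) ((F ^^ i) 0) - (F ^^ (L - j)) ((F ^^ j) 0)"
      by (rule funpow_diff_dvd)
    then have "m dvd (F ^^ (L - j + i)) 0 - (F ^^ L) 0"
      using ij funpow_add[of "L - j" j F] funpow_add[of "L - j" i F] by simp
    moreover have "m dvd (F ^^ L) 0" using iff by simp
    ultimately have "m dvd (F ^^ (L - j + i)) 0" using dvd_diff_left_iff by blast
    then have "L dvd L - j + i" using iff by simp
    then show False using ij by (auto dest: dvd_imp_le)
  qed
qed auto

text \<open>The right side passes to divisors of m and matches \<open>orbit\<close>, whose elements
  are reached after at least one step.\<close>

lemma full_period_iff_orbit_surj:
  "full_period F m \<longleftrightarrow> (\<forall>r. \<exists>i>0. m dvd (F ^^ i) 0 - r)"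
proof
  assume per: "full_period F m"
  have iff: "m dvd (F ^^ i) 0 \<longleftrightarrow> nat m dvd i" for i
    using per m int_dvd_int_iff[of "nat m" i] by (simp add: full_period_def)
  let ?x = "\<lambda>i. (F ^^ i) 0 mod m"
  have "?x ` {..<nat m} = {0..<m}"
    using m inj_on_orbit_mod[OF iff]
    by (intro card_subset_eq) (auto simp: card_image)
  moreover have "r mod m \<in> {0..<m}" for r using m by simp
  ultimately have ex: "\<exists>i. r mod m = ?x i" for r by blast
  show "\<forall>r. \<exists>i>0. m dvd (F ^^ i) 0 - r"
  proof
    fix r
    obtain i where "r mod m = ?x i" using ex by blast
    then have "m dvd (F ^^ i) 0 - r" by (metis mod_eq_dvd_iff)
    \<comment> \<open>A further period makes the time positive in case i = 0.\<close>
    moreover have "m dvd (F ^^ i) ((F ^^ nat m) 0) - (F ^^ i) 0"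
      using iff[of "nat m"] by (intro funpow_diff_dvd) simp
    ultimately have "m dvd ((F ^^ i) ((F ^^ nat m) 0) - (F ^^ i) 0) + ((F ^^ i) 0 - r)"
      by (intro dvd_add)
    then have "m dvd (F ^^ (i + nat m)) 0 - r" by (simp add: funpow_add)
    then show "\<exists>i>0. m dvd (F ^^ i) 0 - r" using m by (intro exI[of _ "i + nat m"]) simp
  qed
next
  assume surj: "\<forall>r. \<exists>i>0. m dvd (F ^^ i) 0 - r"
  \<comment> \<open>\<open>L\<close> is the first positive return time. Residues along the orbit
    repeat with period L, and one period covers all m classes without repetition, so L = m.\<close>
  define L where "L = (LEAST i. i > 0 \<and> m dvd (F ^^ i) 0)"
  have "\<exists>i. i > 0 \<and> m dvd (F ^^ i) 0" using spec[OF surj, of 0] by simp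
  then have L: "L > 0" "m dvd (F ^^ L) 0" and L_le: "\<And>i. i > 0 \<Longrightarrow> m dvd (F ^^ i) 0 \<Longrightarrow> L \<le> i"
    unfolding L_def by (auto dest!: LeastI_ex intro: Least_le)
  have mult: "m dvd (F ^^ (L * a)) 0" for a
  proof (induction a)
    case (Suc a)
    then have "m dvd (F ^^ L) ((F ^^ (L * a)) 0) - (F ^^ L) 0" by (intro funpow_diff_dvd) simp
    then have "m dvd (F ^^ L) ((F ^^ (L * a)) 0)" using L(2) dvd_diff_left_iff by blast
    then show ?case by (simp add: funpow_add)
  qed simp
  have x_mod: "(F ^^ i) 0 mod m = (F ^^ (i mod L)) 0 mod m" for i
  proof -
    have "m dvd (F ^^ (i mod L)) ((F ^^ (L * (i div L))) 0) - (F ^^ (i mod L)) 0"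
      using mult by (intro funpow_diff_dvd) simp
    also have "(F ^^ (i mod L)) ((F ^^ (L * (i div L))) 0) = (F ^^ i) 0"
      using funpow_add[of "i mod L" "L * (i div L)" F] by simp
    finally show ?thesis unfolding mod_eq_dvd_iff .
  qed
  have iff: "m dvd (F ^^ i) 0 \<longleftrightarrow> L dvd i" for i
  proof
    assume "m dvd (F ^^ i) 0"
    then have "m dvd (F ^^ (i mod L)) 0" using x_mod[of i] by (metis dvd_eq_mod_eq_0)
    then have "i mod L = 0" using L_le[of "i mod L"] L(1) by (meson gr0I leD mod_less_divisor)
    then show "L dvd i" by auto
  qed (use mult in auto)
  let ?x = "\<lambda>i. (F ^^ i) 0 mod m"
  have "?x ` {..<L} = {0..<m}"
  proof
    show "{0..<m} \<subseteq> ?x ` {..<L}"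
    proof
      fix r assume r: "r \<in> {0..<m}"
      obtain i where "m dvd (F ^^ i) 0 - r" using surj by blast
      then have "?x i = r mod m" unfolding mod_eq_dvd_iff .
      then have "r = ?x i" using r by simp
      then have "r = ?x (i mod L)" using x_mod by simp
      then show "r \<in> ?x ` {..<L}" using L(1) by auto
    qed
  qed (use m in auto)
  moreover have "card (?x ` {..<L}) = L" using inj_on_orbit_mod[OF iff] by (simp add: card_image)
  ultimately have "int L = m" using m by simp
  then have "m dvd int i \<longleftrightarrow> L dvd i" for i by (metis int_dvd_int_iff)
  then show "full_period F m" unfolding full_period_def using iff by blast
qed

end

lemma full_period_poly_dvd:
  fixes P :: "int poly"
  assumes "full_period (poly P) m" "d dvd m" "m > 0" "d > 0"
  shows "full_period (poly P) d"
proof -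
  have "\<forall>r. \<exists>i>0. m dvd (poly P ^^ i) 0 - r"
    using full_period_iff_orbit_surj[of m "poly P"] assms poly_diff_dvd by blast
  then have "\<forall>r. \<exists>i>0. d dvd (poly P ^^ i) 0 - r" using assms(2) dvd_trans by blast
  then show ?thesis
    using full_period_iff_orbit_surj[of d "poly P"] assms poly_diff_dvd by blast
qed

text \<open>Surjectivity, not injectivity, passes to divisors directly; finiteness converts between
  the two at both moduli.\<close>

lemma inj_mod_poly_dvd:
  fixes P :: "int poly"
  assumes inj: "\<forall>x y. m dvd poly P x - poly P y \<longrightarrow> m dvd x - y" and dvd: "d dvd m" and "m > 0" "d > 0"
  shows "\<forall>x y. d dvd poly P x - poly P y \<longrightarrow> d dvd x - y"
proof -
  have bij: "bij_betw (\<lambda>r. poly P r mod m) {0..<m} {0..<m}"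
    using inj_mod_iff_bij_betw[of m "poly P"] poly_diff_dvd inj \<open>m > 0\<close> by blast
  have "(\<lambda>r. poly P r mod d) ` {0..<d} = {0..<d}"
  proof
    show "{0..<d} \<subseteq> (\<lambda>r. poly P r mod d) ` {0..<d}"
    proof
      fix r assume r: "r \<in> {0..<d}"
      have "r mod m \<in> (\<lambda>r. poly P r mod m) ` {0..<m}"
        using bij_betw_imp_surj_on[OF bij] \<open>m > 0\<close> by simp
      then obtain s where "r mod m = poly P s mod m" by blast
      then have "d dvd r - poly P s" using dvd dvd_trans by (metis mod_eq_dvd_iff)
      then have "r mod d = poly P s mod d" unfolding mod_eq_dvd_iff .
      also have "\<dots> = poly P (s mod d) mod d" by (rule poly_mod_cong) simp
      finally have "r mod d = poly P (s mod d) mod d" .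
      then show "r \<in> (\<lambda>r. poly P r mod d) ` {0..<d}" using r \<open>d > 0\<close> by auto
    qed
  qed (use \<open>d > 0\<close> in auto)
  then have "bij_betw (\<lambda>r. poly P r mod d) {0..<d} {0..<d}"
    by (simp add: bij_betw_def eq_card_imp_inj_on)
  then show ?thesis using inj_mod_iff_bij_betw[of d "poly P"] poly_diff_dvd \<open>d > 0\<close> by blast
qed

section \<open>Induced maps on residues expressed through polynomials\<close>

lemma induces_mod_unique:
  fixes f :: "'p :: prime_card padic_int \<Rightarrow> 'p padic_int"
  assumes "induces_mod f k g" "induces_mod f k h" "r \<in> {0..<int CARD('p) ^ k}"
  shows "g r = h r"
  using assms padic_residue_of_int_self[OF assms(3)] unfolding induces_mod_def by metis

lemma induces_mod_poly_lower:
  fixes f :: "'p :: prime_card padic_int \<Rightarrow> 'p padic_int"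
  assumes "induces_mod f k (\<lambda>r. poly P r mod int CARD('p) ^ k)" "j \<le> k"
  shows "induces_mod f j (\<lambda>r. poly P r mod int CARD('p) ^ j)"
  unfolding induces_mod_def
proof
  fix x
  let ?p = "int CARD('p)"
  have "padic_residue (f x) j = poly P (padic_residue x k) mod ?p ^ k mod ?p ^ j"
    using assms padic_residue_mod[of j k "f x"] by (simp add: induces_mod_def)
  also have "\<dots> = poly P (padic_residue x k) mod ?p ^ j"
    using assms(2) by (intro mod_mod_cancel le_imp_power_dvd)
  also have "\<dots> = poly P (padic_residue x j) mod ?p ^ j"
  proof -
    have "padic_residue x k mod ?p ^ j = padic_residue x j mod ?p ^ j"
      using padic_residue_mod[OF assms(2), of x] by simp
    then show ?thesis by (rule poly_mod_cong)
  qed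
  finally show "padic_residue (f x) j = poly P (padic_residue x j) mod ?p ^ j" .
qed

lemma bijective_mod_iff_poly:
  fixes f :: "'p :: prime_card padic_int \<Rightarrow> 'p padic_int"
  defines "q \<equiv> \<lambda>k. int CARD('p) ^ k"
  assumes P: "induces_mod f k (\<lambda>r. poly P r mod q k)"
  shows "bijective_mod f k \<longleftrightarrow> (\<forall>x y. q k dvd poly P x - poly P y \<longrightarrow> q k dvd x - y)"
proof -
  have "bijective_mod f k \<longleftrightarrow> bij_betw (\<lambda>r. poly P r mod q k) {0..<q k} {0..<q k}"
  proof
    assume "bijective_mod f k"
    then obtain g where g: "induces_mod f k g" "bij_betw g {0..<q k} {0..<q k}"
      by (auto simp: bijective_mod_def q_def)
    have "g r = poly P r mod q k" if "r \<in> {0..<q k}" for r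
      using induces_mod_unique[OF g(1) P] that by (simp add: q_def)
    then show "bij_betw (\<lambda>r. poly P r mod q k) {0..<q k} {0..<q k}"
      using g(2) bij_betw_cong[of "{0..<q k}" g "\<lambda>r. poly P r mod q k"] by simp
  qed (use P in \<open>auto simp: bijective_mod_def q_def\<close>)
  moreover have "q k > 0" by (simp add: q_def)
  ultimately show ?thesis using inj_mod_iff_bij_betw[of "q k" "poly P"] poly_diff_dvd by blast
qed

lemma transitive_mod_iff_full_period:
  fixes f :: "'p :: prime_card padic_int \<Rightarrow> 'p padic_int"
  assumes P: "induces_mod f k (\<lambda>r. poly P r mod int CARD('p) ^ k)"
  shows "transitive_mod f k \<longleftrightarrow> full_period (poly P) (int CARD('p) ^ k)"
proof -
  define q where "q = int CARD('p) ^ k"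
  define h where "h = (\<lambda>r. poly P r mod q)"
  have h: "induces_mod f k h" using P by (simp add: h_def q_def)
  have q0: "q > 0" by (simp add: q_def)
  have hmod: "h (y mod q) = poly P y mod q" for y
    unfolding h_def by (rule poly_mod_cong) simp
  \<comment> \<open>Any inducing g agrees with h on residues, so its orbit of 0 is the reduced
    polynomial orbit.\<close>
  have pow: "(g ^^ i) 0 = (poly P ^^ i) 0 mod q" if g: "induces_mod f k g" for g i
  proof (induction i)
    case (Suc i)
    have "g ((poly P ^^ i) 0 mod q) = h ((poly P ^^ i) 0 mod q)"
      using q0 by (intro induces_mod_unique[OF g h]) (simp add: q_def)
    then show ?case using Suc by (simp add: hmod)
  qed simp
  have surj_iff: "full_period (poly P) q \<longleftrightarrow> (\<forall>r. \<exists>i>0. q dvd (poly P ^^ i) 0 - r)"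
    using full_period_iff_orbit_surj[of q "poly P"] poly_diff_dvd q0 by blast
  have "transitive_mod f k \<longleftrightarrow> full_period (poly P) q"
  proof
    assume "transitive_mod f k"
    then obtain g where g: "induces_mod f k g" "cyclic_on g {0..<q}"
      by (auto simp: transitive_mod_def q_def)
    then have orb: "{0..<q} = orbit g 0" using q0 by (simp add: cyclic_on_alldef)
    have "\<exists>i>0. q dvd (poly P ^^ i) 0 - r" for r
    proof -
      have "r mod q \<in> orbit g 0" using q0 by (simp flip: orb)
      then obtain i where "i > 0" "r mod q = (g ^^ i) 0" by (auto simp: orbit_altdef)
      then show ?thesis using pow[OF g(1)] by (metis mod_eq_dvd_iff)
    qed
    then show "full_period (poly P) q" using surj_iff by blast
  next
    assume "full_period (poly P) q"
    then have surj: "\<exists>i>0. q dvd (poly P ^^ i) 0 - r" for r using surj_iff by blast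
    have ex: "\<exists>i>0. r = (h ^^ i) 0" if "r \<in> {0..<q}" for r
    proof -
      obtain i where i: "i > 0" "q dvd (poly P ^^ i) 0 - r" using surj by blast
      then have "(poly P ^^ i) 0 mod q = r mod q" unfolding mod_eq_dvd_iff by simp
      then show ?thesis using i(1) that pow[OF h, of i] by (intro exI[of _ i]) simp
    qed
    have inS: "(h ^^ i) 0 \<in> {0..<q}" for i using q0 by (simp add: pow[OF h])
    have "{0..<q} = orbit h 0" using ex inS unfolding orbit_altdef by blast
    moreover have "0 \<in> {0..<q}" using q0 by simp
    ultimately have "cyclic_on h {0..<q}" by (intro cyclic_on_singleI)
    \<comment> \<open>Each residue is reached after a positive number of steps and so has a
      predecessor on the orbit.\<close>
    moreover have "h ` {0..<q} = {0..<q}"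
    proof
      show "{0..<q} \<subseteq> h ` {0..<q}"
      proof
        fix r assume "r \<in> {0..<q}"
        then obtain i where "i > 0" "r = (h ^^ i) 0" using ex by blast
        then have "r = h ((h ^^ (i - 1)) 0)" by (cases i) auto
        then show "r \<in> h ` {0..<q}" using inS by blast
      qed
    qed (use q0 in \<open>auto simp: h_def\<close>)
    then have "bij_betw h {0..<q} {0..<q}" by (simp add: bij_betw_def eq_card_imp_inj_on)
    ultimately show "transitive_mod f k" using h by (auto simp: transitive_mod_def q_def)
  qed
  then show ?thesis by (simp add: q_def)
qed

text \<open>The polynomial depends on the level k but serves all lower levels, so two levels can be
  compared through the one for their maximum.\<close>

lemma padic_B_induces_poly:
  fixes f :: "'p :: prime_card padic_int \<Rightarrow> 'p padic_int"
  assumes "f \<in> padic_B"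
  shows "\<exists>P. \<forall>j\<le>k. induces_mod f j (\<lambda>r. poly P r mod int CARD('p) ^ j)"
proof -
  obtain P where "induces_mod f k (\<lambda>r. poly P r mod int CARD('p) ^ k)"
    using padic_B_poly_mod[OF assms, of k] by (auto simp: induces_mod_def)
  then show ?thesis using induces_mod_poly_lower by blast
qed

lemma padic_B_induces_mod:
  fixes f :: "'p :: prime_card padic_int \<Rightarrow> 'p padic_int"
  assumes "f \<in> padic_B"
  shows "\<exists>g. induces_mod f k g"
  using padic_B_induces_poly[OF assms, of k] by blast

lemma padic_B_bijective_mod_lift:
  fixes f :: "'p :: prime_card padic_int \<Rightarrow> 'p padic_int"
  assumes f: "f \<in> padic_B" and bij: "bijective_mod f 2"
  shows "bijective_mod f k"
proof -
  let ?p = "int CARD('p)"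
  obtain P where P: "\<And>j. j \<le> max k 2 \<Longrightarrow> induces_mod f j (\<lambda>r. poly P r mod ?p ^ j)"
    using padic_B_induces_poly[OF f, of "max k 2"] by auto
  have inj2: "\<forall>x y. ?p ^ 2 dvd poly P x - poly P y \<longrightarrow> ?p ^ 2 dvd x - y"
    using bij bijective_mod_iff_poly[OF P, of 2] by simp
  have p0: "?p > 0" using p_gt_1[where 'p = 'p] by simp
  then have inj1: "\<forall>x y. ?p dvd poly P x - poly P y \<longrightarrow> ?p dvd x - y"
    by (intro inj_mod_poly_dvd[OF inj2]) simp_all
  have "\<forall>x y. ?p ^ k dvd poly P x - poly P y \<longrightarrow> ?p ^ k dvd x - y"
    using poly_inj_mod_prime_power[OF prime_card_int[where 'a = 'p], of P] inj1 inj2 by blast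
  then show ?thesis using bijective_mod_iff_poly[OF P, of k] by simp
qed

lemma padic_B_transitive_mod_lift:
  fixes f :: "'p :: prime_card padic_int \<Rightarrow> 'p padic_int"
  assumes f: "f \<in> padic_B" and tr: "transitive_mod f n" and n: "n \<ge> 2" "CARD('p) \<le> 3 \<Longrightarrow> n \<ge> 3"
  shows "transitive_mod f k"
proof -
  let ?p = "int CARD('p)"
  obtain P where P: "\<And>j. j \<le> max k n \<Longrightarrow> induces_mod f j (\<lambda>r. poly P r mod ?p ^ j)"
    using padic_B_induces_poly[OF f, of "max k n"] by auto
  have per: "full_period (poly P) (?p ^ n)"
    using tr transitive_mod_iff_full_period[OF P, of n] by simp
  have "full_period (poly P) (?p ^ k)"
  proof (rule full_period_all_powers[OF prime_card_int _ n(1)])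
    show "full_period (poly P) (?p ^ j)" if "j \<le> n" for j
      using that by (intro full_period_poly_dvd[OF per]) (simp_all add: le_imp_power_dvd)
  qed (use n(2) in simp)
  then show ?thesis using transitive_mod_iff_full_period[OF P, of k] by simp
qed

section \<open>The criteria for functions in B\<close>

lemma padic_B_measure_preserving_iff:
  assumes f: "f \<in> padic_B"
  shows "measure_preserving f \<longleftrightarrow> bijective_mod f 2"
proof
  assume mp: "measure_preserving f"
  obtain g where g: "induces_mod f 2 g" using padic_B_induces_mod[OF f] by blast
  then show "bijective_mod f 2"
    using measure_preserving_imp_bij_betw[OF mp g] unfolding bijective_mod_def by blast
next
  assume "bijective_mod f 2"
  then show "measure_preserving f"
    by (rule measure_preserving_if_bijective_mod[OF padic_B_bijective_mod_lift[OF f]])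
qed

text \<open>Keeping n general treats p > 3 with n = 2 and p \<le> 3 with n = 3 at once.\<close>

lemma padic_B_ergodic_iff:
  fixes f :: "'p :: prime_card padic_int \<Rightarrow> 'p padic_int"
  assumes f: "f \<in> padic_B" and n: "n \<ge> 2" "CARD('p) \<le> 3 \<Longrightarrow> n \<ge> 3"
  shows "ergodic f \<longleftrightarrow> transitive_mod f n"
proof
  assume erg: "ergodic f"
  then have mp: "measure_preserving f" by (simp add: ergodic_def)
  obtain g where g: "induces_mod f n g" using padic_B_induces_mod[OF f] by blast
  then show "transitive_mod f n"
    using measure_preserving_imp_bij_betw[OF mp g] ergodic_imp_cyclic_on[OF erg g]
    unfolding transitive_mod_def by blast
next
  assume "transitive_mod f n"
  then show "ergodic f"
    by (rule ergodic_if_transitive_mod[OF padic_B_transitive_mod_lift[OF f _ n]])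
qed

theorem theorem4p9:
  fixes f :: "'p :: prime_card padic_int \<Rightarrow> 'p padic_int"
  assumes "f \<in> padic_B"
  shows "(measure_preserving f \<longleftrightarrow> bijective_mod f 2) \<and>
    (CARD('p) \<notin> {2, 3} \<longrightarrow> (ergodic f \<longleftrightarrow> transitive_mod f 2)) \<and>
    (CARD('p) \<in> {2, 3} \<longrightarrow> (ergodic f \<longleftrightarrow> transitive_mod f 3))"
proof (intro conjI impI)
  show "measure_preserving f \<longleftrightarrow> bijective_mod f 2"
    by (rule padic_B_measure_preserving_iff[OF assms])
  assume "CARD('p) \<notin> {2, 3}"
  then have "CARD('p) > 3" using p_gt_1[where 'p = 'p] by auto
  then show "ergodic f \<longleftrightarrow> transitive_mod f 2" by (intro padic_B_ergodic_iff[OF assms]) auto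
next
  show "ergodic f \<longleftrightarrow> transitive_mod f 3" by (intro padic_B_ergodic_iff[OF assms]) auto
qed

end
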